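(* Let $M$ be any affine, reduced affine, periodic or reduced periodic planar diagram monoid (of Temperley--Lieb, Motzkin or planar rook type), with group of units $G$, and let $k$ be any algebraically closed field. If $V$ is a finite-dimensional $kM$-module on which no nonunit of $M$ acts invertibly, and such that $\mathrm{Res}_G(V)$ is faithful, then $l(n)\sim(\dim V)^n$.
   Context: $V^{\otimes n}$ carries the diagonal action of $M$; $l(n)$ is the number of composition factors of the $kM$-module $V^{\otimes n}$, counted with multiplicity. $\mathrm{Res}_G(V)$ is the restriction of $V$ to $G$. $f(n)\sim g(n)$ means $f(n)/g(n)\to1$ as $n\to\infty$. Fix $m\ge1$. An affine partition $m$-diagram consists of the strip $\mathbb R\times[0,1]$ with one vertex at each point of $\mathbb Z\times\{0,1\}$ (bottom and top vertices), edges between vertices (at most one between any two) and finitely many horizontal lines (non-contractible loops), invariant under translation by $m$; two diagrams are equal if they induce the same set partition of the vertices and have the same number of non-contractible loops. Diagrams are composed by stacking, identifying the middle vertices, deleting closed (contractible) components, and juxtaposing the non-contractible loops. The affine planar monoids are: Temperley--Lieb $\overline{aTL_m}$ (planar, i.e. crossing-free, diagrams with all components of size $2$); Motzkin $\overline{aMo_m}$ (planar diagrams with all components of size $\le2$); planar rook $aPRo_m$ (planar diagrams without non-contractible loops, all components with at most one top and at most one bottom vertex). The reduced affine monoids consist of the diagrams without non-contractible loops, with any non-contractible loops arising in a product deleted. The periodic (resp. reduced periodic) monoids are the submonoids of the affine (resp. reduced affine) ones generated by: $e_i$ for Temperley--Lieb; $e_i,l_i,r_i$ for Motzkin; $l_i,r_i$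 for planar rook ($0\le i\le m-1$). Here (up to translation by $m$, with vertical lines elsewhere) $e_i$ joins the top vertices $i,i+1$ and the bottom vertices $i,i+1$; $l_i$ joins top $i+1$ to bottom $i$, leaving top $i$ and bottom $i+1$ isolated; $r_i$ joins top $i$ to bottom $i+1$, leaving top $i+1$ and bottom $i$ isolated. *)

theory Defs
  imports
    "HOL-Algebra.Group"
    "HOL-Computational_Algebra.Polynomial"
    "HOL-Library.Disjoint_Sets"
    "HOL-Library.Landau_Symbols"
    "HOL-Library.Poly_Mapping"
    "HOL-Number_Theory.Cong"
begin

section \<open>Affine planar diagrams\<close>

text \<open>
  A vertex is a point of \<open>\<int> \<times> {0, 1}\<close>; height 0 is the bottom and height 1 the top boundary of the
  strip. A diagram is identified with the set partition of the vertices that it induces (the set of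
  its components) together with its number of non-contractible loops.
\<close>

type_synonym vertex = "int \<times> nat"
type_synonym diagram = "vertex set set \<times> nat"

definition translate :: "int \<Rightarrow> vertex \<Rightarrow> vertex" where
  "translate s = (\<lambda>(x, h). (x + s, h))"

definition affine_partition_diagrams :: "nat \<Rightarrow> diagram set" where
  "affine_partition_diagrams m =
     {(P, c). partition_on (UNIV \<times> {0, 1}) P \<and> (\<forall>B\<in>P. translate (int m) ` B \<in> P)}"

text \<open>
  The linear order on vertices below runs along the boundary of the strip: the bottom line from left
  to right, then the top line from right to left. Two components can be drawn in the strip without
  crossing each other iff their vertices do not interlace in this order. A non-contractible loop
  separates the bottom from the top, so it crosses precisely the components with vertices on both
  sides.
\<close>

definition boundary_less :: "vertex \<Rightarrow> vertex \<Rightarrow> bool" where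
  "boundary_less = (\<lambda>(x, h) (y, k). h < k \<or> (h = k \<and> (if h = 0 then x < y else y < x)))"

definition interlaced :: "vertex set \<Rightarrow> vertex set \<Rightarrow> bool" where
  "interlaced B C \<longleftrightarrow>
     (\<exists>a\<in>B. \<exists>b\<in>C. \<exists>a'\<in>B. \<exists>b'\<in>C. boundary_less a b \<and> boundary_less b a' \<and> boundary_less a' b')"

definition bottom_part :: "vertex set \<Rightarrow> vertex set" where
  "bottom_part B = {v \<in> B. snd v = 0}"

definition top_part :: "vertex set \<Rightarrow> vertex set" where
  "top_part B = {v \<in> B. snd v = 1}"

definition planar :: "diagram \<Rightarrow> bool" where
  "planar = (\<lambda>(P, c). (\<forall>B\<in>P. \<forall>C\<in>P. B \<noteq> C \<longrightarrow> \<not> interlaced B C)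
     \<and> (c > 0 \<longrightarrow> (\<forall>B\<in>P. top_part B = {} \<or> bottom_part B = {})))"

text \<open>
  Stacking \<open>P\<close> on top of \<open>Q\<close> gives a graph on \<open>\<int> \<times> {0, 1, 2}\<close>, in which the bottom of \<open>P\<close> and the top
  of \<open>Q\<close> are both at height 1. A component contained in the middle level is contractible iff it is
  finite: by periodicity, an infinite one contains a vertex and a proper translate of it by a
  multiple of \<open>m\<close>.
\<close>

definition stack_components :: "vertex set set \<Rightarrow> vertex set set \<Rightarrow> vertex set set" where
  "stack_components P Q =
     (UNIV \<times> {0, 1, 2}) //
       (\<Union>B \<in> (\<lambda>B. (\<lambda>(x, h). (x, Suc h)) ` B) ` P \<union> Q. B \<times> B)\<^sup>*"

definition middle :: "vertex set" where
  "middle = UNIV \<times> {1}"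

definition stack_partition :: "vertex set set \<Rightarrow> vertex set set \<Rightarrow> vertex set set" where
  "stack_partition P Q =
     {(\<lambda>(x, h). (x, h div 2)) ` (C - middle) | C. C \<in> stack_components P Q \<and> \<not> C \<subseteq> middle}"

definition new_loops :: "vertex set set \<Rightarrow> vertex set set \<Rightarrow> nat" where
  "new_loops P Q = card {C \<in> stack_components P Q. C \<subseteq> middle \<and> infinite C}"

definition affine_mult :: "diagram \<Rightarrow> diagram \<Rightarrow> diagram" where
  "affine_mult = (\<lambda>(P, c) (Q, d). (stack_partition P Q, c + d + new_loops P Q))"

definition reduced_mult :: "diagram \<Rightarrow> diagram \<Rightarrow> diagram" where
  "reduced_mult = (\<lambda>(P, c) (Q, d). (stack_partition P Q, 0))"

definition id_diagram :: diagram where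
  "id_diagram = ({{(x, 1), (x, 0)} | x. True}, 0)"


section \<open>The planar diagram monoids\<close>

datatype planar_type = Temperley_Lieb | Motzkin | Planar_Rook

fun planar_diagrams :: "planar_type \<Rightarrow> nat \<Rightarrow> diagram set" where
  "planar_diagrams Temperley_Lieb m =
     {(P, c) \<in> affine_partition_diagrams m. planar (P, c) \<and> (\<forall>B\<in>P. card B = 2)}"
| "planar_diagrams Motzkin m =
     {(P, c) \<in> affine_partition_diagrams m. planar (P, c) \<and> (\<forall>B\<in>P. finite B \<and> card B \<le> 2)}"
| "planar_diagrams Planar_Rook m =
     {(P, c) \<in> affine_partition_diagrams m. planar (P, c) \<and> c = 0 \<and>
        (\<forall>B\<in>P. finite B \<and> card (top_part B) \<le> 1 \<and> card (bottom_part B) \<le> 1)}"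

definition affine_monoid :: "planar_type \<Rightarrow> nat \<Rightarrow> diagram monoid" where
  "affine_monoid t m = \<lparr>carrier = planar_diagrams t m, monoid.mult = affine_mult, one = id_diagram\<rparr>"

definition reduced_affine_monoid :: "planar_type \<Rightarrow> nat \<Rightarrow> diagram monoid" where
  "reduced_affine_monoid t m =
     \<lparr>carrier = {(P, c) \<in> planar_diagrams t m. c = 0}, monoid.mult = reduced_mult, one = id_diagram\<rparr>"

text \<open>
  The components in \<open>Bs\<close>, repeated with period \<open>m\<close>, and vertical lines at all positions not congruent
  to \<open>i\<close> or \<open>i + 1\<close>.
\<close>

definition periodic_diagram :: "nat \<Rightarrow> int \<Rightarrow> vertex set set \<Rightarrow> diagram" where
  "periodic_diagram m i Bs =
     ({translate (q * int m) ` B | q B. B \<in> Bs} \<union>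
      {{(x, 1), (x, 0)} | x. \<not> [x = i] (mod int m) \<and> \<not> [x = i + 1] (mod int m)}, 0)"

definition e_diagram :: "nat \<Rightarrow> int \<Rightarrow> diagram" where
  "e_diagram m i = periodic_diagram m i {{(i, 1), (i + 1, 1)}, {(i, 0), (i + 1, 0)}}"

definition l_diagram :: "nat \<Rightarrow> int \<Rightarrow> diagram" where
  "l_diagram m i = periodic_diagram m i {{(i + 1, 1), (i, 0)}, {(i, 1)}, {(i + 1, 0)}}"

definition r_diagram :: "nat \<Rightarrow> int \<Rightarrow> diagram" where
  "r_diagram m i = periodic_diagram m i {{(i, 1), (i + 1, 0)}, {(i + 1, 1)}, {(i, 0)}}"

fun generators :: "planar_type \<Rightarrow> nat \<Rightarrow> diagram set" where
  "generators Temperley_Lieb m = e_diagram m ` {0..<int m}"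
| "generators Motzkin m =
     e_diagram m ` {0..<int m} \<union> l_diagram m ` {0..<int m} \<union> r_diagram m ` {0..<int m}"
| "generators Planar_Rook m = l_diagram m ` {0..<int m} \<union> r_diagram m ` {0..<int m}"

inductive_set submonoid_span :: "('a, 'b) monoid_scheme \<Rightarrow> 'a set \<Rightarrow> 'a set"
  for G and H where
  one: "\<one>\<^bsub>G\<^esub> \<in> submonoid_span G H"
| incl: "h \<in> H \<Longrightarrow> h \<in> submonoid_span G H"
| mult: "g \<in> submonoid_span G H \<Longrightarrow> h \<in> submonoid_span G H \<Longrightarrow> g \<otimes>\<^bsub>G\<^esub> h \<in> submonoid_span G H"

text \<open>
  The intersection with the carrier matters only for \<open>m = 1\<close>. There the prescriptions for \<open>e\<close>, \<open>l\<close>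
  and \<open>r\<close> are not compatible with translation by 1 (the prescribed components overlap) and define no
  element of the monoid; for \<open>m \<ge> 2\<close> all of the generators lie in the carrier.
\<close>

definition generated_submonoid :: "('a, 'b) monoid_scheme \<Rightarrow> 'a set \<Rightarrow> ('a, 'b) monoid_scheme" where
  "generated_submonoid G H = G\<lparr>carrier := submonoid_span G (H \<inter> carrier G)\<rparr>"

datatype variant = Affine | Reduced_Affine | Periodic | Reduced_Periodic

fun planar_diagram_monoid :: "variant \<Rightarrow> planar_type \<Rightarrow> nat \<Rightarrow> diagram monoid" where
  "planar_diagram_monoid Affine t m = affine_monoid t m"
| "planar_diagram_monoid Reduced_Affine t m = reduced_affine_monoid t m"
| "planar_diagram_monoid Periodic t m = generated_submonoid (affine_monoid t m) (generators t m)"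
| "planar_diagram_monoid Reduced_Periodic t m =
     generated_submonoid (reduced_affine_monoid t m) (generators t m)"


section \<open>Modules over monoid algebras and their tensor powers\<close>

text \<open>
  A \<open>kM\<close>-module is a \<open>k\<close>-vector space (here the whole type) with a \<open>k\<close>-linear action of \<open>M\<close>.
\<close>

locale fin_dim_monoid_module = vector_space scale
  for scale :: "'k::field \<Rightarrow> 'v::ab_group_add \<Rightarrow> 'v" +
  fixes M :: "('a, 'b) monoid_scheme" and \<rho> :: "'a \<Rightarrow> 'v \<Rightarrow> 'v"
  assumes fin_dim: "\<exists>S. finite S \<and> span S = UNIV"
    and action_linear: "x \<in> carrier M \<Longrightarrow> Vector_Spaces.linear scale scale (\<rho> x)"
    and action_one: "\<rho> \<one>\<^bsub>M\<^esub> = id"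
    and action_mult: "x \<in> carrier M \<Longrightarrow> y \<in> carrier M \<Longrightarrow> \<rho> (x \<otimes>\<^bsub>M\<^esub> y) = \<rho> x \<circ> \<rho> y"

text \<open>
  \<open>V\<^sup>\<otimes>\<^sup>n\<close> is the quotient of the free vector space on the \<open>n\<close>-tuples of vectors (lists of length \<open>n\<close>) by
  the subspace spanned by the multilinearity relations. The free spaces for all \<open>n\<close> are realised as
  subspaces of the finitely supported functions on lists.
\<close>

definition free_scale :: "'k::field \<Rightarrow> ('x \<Rightarrow>\<^sub>0 'k) \<Rightarrow> ('x \<Rightarrow>\<^sub>0 'k)" where
  "free_scale c = Poly_Mapping.map ((*) c)"

definition free_tuples :: "nat \<Rightarrow> ('v list \<Rightarrow>\<^sub>0 'k::field) set" where
  "free_tuples n = {f. Poly_Mapping.keys f \<subseteq> {vs. length vs = n}}"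

definition multilinear_relators ::
    "('k::field \<Rightarrow> 'v::ab_group_add \<Rightarrow> 'v) \<Rightarrow> nat \<Rightarrow> ('v list \<Rightarrow>\<^sub>0 'k) set" where
  "multilinear_relators scale n =
     {Poly_Mapping.single (us @ (a + b) # ws) 1 - Poly_Mapping.single (us @ a # ws) 1
        - Poly_Mapping.single (us @ b # ws) 1 | us a b ws. length us + 1 + length ws = n} \<union>
     {Poly_Mapping.single (us @ scale c a # ws) 1 - free_scale c (Poly_Mapping.single (us @ a # ws) 1)
        | us c a ws. length us + 1 + length ws = n}"

definition tensor_relations ::
    "('k::field \<Rightarrow> 'v::ab_group_add \<Rightarrow> 'v) \<Rightarrow> nat \<Rightarrow> ('v list \<Rightarrow>\<^sub>0 'k) set" where
  "tensor_relations scale n = module.span free_scale (multilinear_relators scale n)"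

text \<open>The linear extension of \<open>[v\<^sub>1, \<dots>, v\<^sub>n] \<mapsto> [g v\<^sub>1, \<dots>, g v\<^sub>n]\<close>.\<close>

definition diagonal_action :: "('a \<Rightarrow> 'v \<Rightarrow> 'v) \<Rightarrow> 'a \<Rightarrow> ('v list \<Rightarrow>\<^sub>0 'k::field) \<Rightarrow> ('v list \<Rightarrow>\<^sub>0 'k)" where
  "diagonal_action \<rho> g f =
     (\<Sum>vs\<in>Poly_Mapping.keys f. Poly_Mapping.single (map (\<rho> g) vs) (Poly_Mapping.lookup f vs))"

text \<open>
  Submodules of a quotient \<open>F / R\<close> are identified with the invariant subspaces of \<open>F\<close> containing \<open>R\<close>.
  The factor of two consecutive submodules in a composition series is simple, i.e. the first is
  properly contained in the second and no submodule lies strictly between them.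
\<close>

definition quotient_submodule ::
    "('k::field \<Rightarrow> 'w::ab_group_add \<Rightarrow> 'w) \<Rightarrow> 'a set \<Rightarrow> ('a \<Rightarrow> 'w \<Rightarrow> 'w) \<Rightarrow> 'w set \<Rightarrow> 'w set \<Rightarrow> 'w set \<Rightarrow> bool"
  where
  "quotient_submodule scale S act F R U \<longleftrightarrow>
     module.subspace scale U \<and> R \<subseteq> U \<and> U \<subseteq> F \<and> (\<forall>g\<in>S. act g ` U \<subseteq> U)"

definition composition_series ::
    "('k::field \<Rightarrow> 'w::ab_group_add \<Rightarrow> 'w) \<Rightarrow> 'a set \<Rightarrow> ('a \<Rightarrow> 'w \<Rightarrow> 'w) \<Rightarrow> 'w set \<Rightarrow> 'w set \<Rightarrow> 'w set list \<Rightarrow> bool"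
  where
  "composition_series scale S act F R Us \<longleftrightarrow>
     Us \<noteq> [] \<and> hd Us = R \<and> last Us = F \<and>
     (\<forall>U\<in>set Us. quotient_submodule scale S act F R U) \<and>
     (\<forall>i. Suc i < length Us \<longrightarrow> Us ! i \<subset> Us ! Suc i \<and>
        \<not> (\<exists>W. quotient_submodule scale S act F R W \<and> Us ! i \<subset> W \<and> W \<subset> Us ! Suc i))"

definition composition_length ::
    "('k::field \<Rightarrow> 'w::ab_group_add \<Rightarrow> 'w) \<Rightarrow> 'a set \<Rightarrow> ('a \<Rightarrow> 'w \<Rightarrow> 'w) \<Rightarrow> 'w set \<Rightarrow> 'w set \<Rightarrow> nat" where
  "composition_length scale S act F R =
     (THE l. \<exists>Us. composition_series scale S act F R Us \<and> length Us = Suc l)"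

definition tensor_power_length ::
    "('k::field \<Rightarrow> 'v::ab_group_add \<Rightarrow> 'v) \<Rightarrow> ('a, 'b) monoid_scheme \<Rightarrow> ('a \<Rightarrow> 'v \<Rightarrow> 'v) \<Rightarrow> nat \<Rightarrow> nat" where
  "tensor_power_length scale M \<rho> n =
     composition_length free_scale (carrier M) (diagonal_action \<rho>)
       (free_tuples n) (tensor_relations scale n)"

end

theory Submission
  imports Defs
begin

text \<open>
  Let \<open>d = dim V\<close>. The upper bound \<open>l(n) \<le> d\<^sup>n\<close> is clear, since \<open>d\<^sup>n\<close> is the dimension of \<open>V\<^sup>\<otimes>\<^sup>n\<close>. For the
  lower bound the point is that the nonunits of \<open>M\<close> act with small image. A nonunit \<open>x\<close> is not
  invertible on \<open>V\<close>, so its image there has dimension at most \<open>d - 1\<close>, and its image on \<open>V\<^sup>\<otimes>\<^sup>n\<close> has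
  dimension at most \<open>(d - 1)\<^sup>n\<close>, which is negligible against \<open>d\<^sup>n\<close>. All nonunits factor on the left
  through \<^emph>\<open>finitely many\<close> nonunits \<open>x\<^sub>1, \<dots>, x\<^sub>r\<close>, so the images of all nonunits on \<open>V\<^sup>\<otimes>\<^sup>n\<close> lie in a submodule \<open>W\<close>
  of dimension at most \<open>r (d - 1)\<^sup>n\<close>. On the quotient \<open>V\<^sup>\<otimes>\<^sup>n / W\<close> the nonunits act as zero and the
  units, which are rotations, commute. Over an algebraically closed field commuting operators have
  common eigenvectors, hence all composition factors of the quotient are lines and
  \<open>d\<^sup>n - r (d - 1)\<^sup>n \<le> l(n) \<le> d\<^sup>n\<close>.

  The linear algebra is in \<open>codim_le_composition_length\<close>, with the Jordan-Hoelder theorem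
  (\<open>card_chain_le_series\<close>) to make the length meaningful, in \<open>codim_tensor_relations\<close> (the dimension of
  the tensor power) and in \<open>diagonal_action_image\<close> (the size of the images); \<open>tensor_power_length_bounds\<close>
  combines them for an abstract monoid.

  For the periodic monoids the generators play the role of the \<open>x\<^sub>j\<close>. In the affine monoids a diagram
  is a rotation unless it has an isolated top vertex or joins two top vertices, and in the latter
  case an innermost such component joins adjacent vertices (\<open>planar_diagram_cases\<close>). The \<open>x\<^sub>j\<close> are the idempotents
  that consist of such a component in the top row, its mirror image in the bottom row, and vertical
  lines; stacked on top of a diagram that has this component they change nothing
  (\<open>stack_cap_blocks\<close>). Products of diagrams are computed by retracting the stack onto one of its
  parts (\<open>stack_components_retract\<close>).
\<close>


section \<open>Codimension relative to a subspace\<close>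

locale ambient_space = vector_space scale
  for scale :: "'k::field \<Rightarrow> 'w::ab_group_add \<Rightarrow> 'w"
begin

text \<open>
  The dimension of \<open>F / U\<close> is measured inside the ambient space, as the least number of vectors that
  together with \<open>U\<close> span \<open>F\<close>. With this definition enlarging \<open>U\<close> by finitely many vectors obviously
  lowers the codimension by at most their number; the converse direction is an exchange argument.
\<close>

definition finite_codim :: "'w set \<Rightarrow> 'w set \<Rightarrow> bool" where
  "finite_codim F U \<longleftrightarrow> (\<exists>T. finite T \<and> F \<subseteq> span (U \<union> T))"

definition codim :: "'w set \<Rightarrow> 'w set \<Rightarrow> nat" where
  "codim F U = (LEAST n. \<exists>T. finite T \<and> card T = n \<and> F \<subseteq> span (U \<union> T))"

lemma finite_codim_mono: "finite_codim F U \<Longrightarrow> U \<subseteq> U' \<Longrightarrow> finite_codim F U'"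
  unfolding finite_codim_def by (meson Un_mono order_refl order_trans span_mono)

lemma codim_le: "finite T \<Longrightarrow> F \<subseteq> span (U \<union> T) \<Longrightarrow> codim F U \<le> card T"
  unfolding codim_def by (rule Least_le) auto

lemma codim_witness:
  assumes "finite_codim F U"
  obtains T where "finite T" "card T = codim F U" "F \<subseteq> span (U \<union> T)"
proof -
  have "\<exists>n. \<exists>T. finite T \<and> card T = n \<and> F \<subseteq> span (U \<union> T)"
    using assms unfolding finite_codim_def by blast
  from LeastI_ex[OF this] show thesis
    using that unfolding codim_def by blast
qed

lemma codim_le_add:
  assumes "finite_codim F U'" "finite T" "U' \<subseteq> span (U \<union> T)"
  shows "codim F U \<le> codim F U' + card T"
proof -
  obtain T' where T': "finite T'" "card T' = codim F U'" "F \<subseteq> span (U' \<union> T')"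
    using codim_witness[OF assms(1)] .
  have "U' \<union> T' \<subseteq> span (U \<union> (T' \<union> T))"
    using assms(3) span_mono[of "U \<union> T" "U \<union> (T' \<union> T)"] span_superset[of "U \<union> (T' \<union> T)"] by blast
  then have "F \<subseteq> span (U \<union> (T' \<union> T))"
    using T'(3) span_minimal[OF _ subspace_span] by blast
  then have "codim F U \<le> card (T' \<union> T)"
    using codim_le T'(1) assms(2) by simp
  also have "\<dots> \<le> card T' + card T"
    by (rule card_Un_le)
  finally show ?thesis
    using T'(2) by simp
qed

text \<open>
  Steinitz exchange modulo \<open>U\<close>: a vector of \<open>U' - U\<close> replaces one of the vectors that complete \<open>U\<close>
  to a spanning set.
\<close>

lemma codim_strict_antimono:
  assumes fin: "finite_codim F U" and U: "subspace U" and "U \<subset> U'" "U' \<subseteq> F"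
  shows "codim F U' < codim F U"
proof -
  obtain w where w: "w \<in> U'" "w \<notin> U"
    using assms(3) by blast
  obtain T where T: "finite T" "card T = codim F U" "F \<subseteq> span (U \<union> T)"
    using codim_witness[OF fin] .
  have "\<exists>s\<in>T. s \<in> span (U' \<union> (T - {s}))"
  proof -
    have "w \<in> span (U \<union> T') \<Longrightarrow> T' \<subseteq> T \<Longrightarrow> \<exists>s\<in>T. s \<in> span (U' \<union> (T - {s}))"
      if "finite T'" for T'
      using that
    proof (induction T' rule: finite_induct)
      case empty
      have "span U = U"
        using U span_eq_iff by blast
      with empty w show ?case by simp
    next
      case (insert s T')
      show ?case
      proof (cases "w \<in> span (U \<union> T')")
        case True
        with insert show ?thesis by blast
      next
        case False
        then have "s \<in> span (insert w (U \<union> T'))"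
          using insert.prems(1) in_span_insert[of w s "U \<union> T'"] by simp
        moreover have "insert w (U \<union> T') \<subseteq> U' \<union> (T - {s})"
          using w insert assms(3) by blast
        ultimately have "s \<in> span (U' \<union> (T - {s}))"
          using span_mono by blast
        then show ?thesis
          using insert.prems(2) by blast
      qed
    qed
    moreover have "w \<in> span (U \<union> T)"
      using w(1) assms(4) T(3) by blast
    ultimately show ?thesis
      using T(1) by blast
  qed
  then obtain s where s: "s \<in> T" "s \<in> span (U' \<union> (T - {s}))" by blast
  have "U \<union> T \<subseteq> span (U' \<union> (T - {s}))"
    using s assms(3) span_superset[of "U' \<union> (T - {s})"] by blast
  then have "F \<subseteq> span (U' \<union> (T - {s}))"
    using T(3) span_minimal[OF _ subspace_span] by blast
  then have "codim F U' \<le> card (T - {s})"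
    using codim_le T(1) by simp
  then show ?thesis
    using T s(1) by (metis card_Diff1_less le_less_trans)
qed

end


section \<open>Composition series\<close>

locale operator_module = ambient_space scale
  for scale :: "'k::field \<Rightarrow> 'w::ab_group_add \<Rightarrow> 'w" +
  fixes S :: "'a set" and act :: "'a \<Rightarrow> 'w \<Rightarrow> 'w" and F R :: "'w set"
  assumes act_linear: "g \<in> S \<Longrightarrow> Vector_Spaces.linear scale scale (act g)"
    and subspace_F: "subspace F" and subspace_R: "subspace R" and R_le_F: "R \<subseteq> F"
    and act_F: "g \<in> S \<Longrightarrow> act g ` F \<subseteq> F" and act_R: "g \<in> S \<Longrightarrow> act g ` R \<subseteq> R"
    and finite_codim_R: "finite_codim F R"
begin

abbreviation submodule :: "'w set \<Rightarrow> bool" where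
  "submodule \<equiv> quotient_submodule scale S act F R"

lemma submoduleD:
  assumes "submodule U"
  shows "subspace U" "R \<subseteq> U" "U \<subseteq> F" "g \<in> S \<Longrightarrow> u \<in> U \<Longrightarrow> act g u \<in> U"
  using assms unfolding quotient_submodule_def by blast+

lemma submodule_F: "submodule F" and submodule_R: "submodule R"
  unfolding quotient_submodule_def
  using subspace_F subspace_R R_le_F act_F act_R by auto

lemma finite_codim_submodule: "submodule U \<Longrightarrow> finite_codim F U"
  using finite_codim_mono[OF finite_codim_R submoduleD(2)] .

lemma codim_submodule_strict:
  "submodule U \<Longrightarrow> submodule U' \<Longrightarrow> U \<subset> U' \<Longrightarrow> codim F U' < codim F U"
  using codim_strict_antimono finite_codim_submodule submoduleD by metis

lemma submodule_Int: "submodule U \<Longrightarrow> submodule W \<Longrightarrow> submodule (U \<inter> W)"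
  by (auto simp: quotient_submodule_def image_subset_iff intro: subspace_inter)

lemma submodule_sum:
  assumes U: "submodule U" and W: "submodule W"
  shows "submodule {x + y |x y. x \<in> U \<and> y \<in> W}"
  unfolding quotient_submodule_def
proof (intro conjI ballI)
  show "subspace {x + y |x y. x \<in> U \<and> y \<in> W}"
    using subspace_sums submoduleD(1) assms by blast
  show "R \<subseteq> {x + y |x y. x \<in> U \<and> y \<in> W}"
    using submoduleD(2)[OF U] subspace_0[OF submoduleD(1)[OF W]] by force
  show "{x + y |x y. x \<in> U \<and> y \<in> W} \<subseteq> F"
    using submoduleD(3)[OF U] submoduleD(3)[OF W] subspace_add[OF subspace_F] by blast
next
  fix g assume g: "g \<in> S"
  show "act g ` {x + y |x y. x \<in> U \<and> y \<in> W} \<subseteq> {x + y |x y. x \<in> U \<and> y \<in> W}"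
  proof clarify
    fix x y assume "x \<in> U" "y \<in> W"
    then have "act g x \<in> U" "act g y \<in> W"
      using submoduleD(4) U W g by auto
    moreover have "act g (x + y) = act g x + act g y"
      using act_linear[OF g] by (simp add: Vector_Spaces.linear_iff)
    ultimately show "\<exists>a b. act g (x + y) = a + b \<and> a \<in> U \<and> b \<in> W"
      by blast
  qed
qed

definition covers :: "'w set \<Rightarrow> 'w set \<Rightarrow> bool" where
  "covers U U' \<longleftrightarrow> U \<subset> U' \<and> \<not> (\<exists>W. submodule W \<and> U \<subset> W \<and> W \<subset> U')"

lemma composition_series_iff:
  "composition_series scale S act F R Us \<longleftrightarrow>
     Us \<noteq> [] \<and> hd Us = R \<and> last Us = F \<and> (\<forall>U\<in>set Us. submodule U) \<and> successively covers Us"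
  unfolding composition_series_def covers_def successively_conv_nth by simp

lemma ex_cover:
  assumes U: "submodule U" "U \<noteq> F"
  obtains U' where "submodule U'" "covers U U'"
proof -
  let ?P = "\<lambda>U'. submodule U' \<and> U \<subset> U'"
  have "?P F"
    using submodule_F submoduleD(3)[OF U(1)] U(2) by blast
  moreover have "\<forall>U'. ?P U' \<longrightarrow> codim F U' < codim F U"
    using codim_submodule_strict U(1) by blast
  ultimately obtain U' where "?P U'" and max: "\<forall>W. ?P W \<longrightarrow> codim F W \<le> codim F U'"
    using ex_has_greatest_nat[of ?P F "codim F" "codim F U"] by auto
  then have U': "submodule U'" "U \<subset> U'" by auto
  have "covers U U'"
    unfolding covers_def using U' max codim_submodule_strict by (metis not_less)
  with U'(1) show thesis using that by blast
qed

lemma composition_series_from: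
  assumes "submodule U"
  shows "\<exists>Us. Us \<noteq> [] \<and> hd Us = U \<and> last Us = F \<and> (\<forall>U\<in>set Us. submodule U) \<and> successively covers Us"
  using assms
proof (induction "codim F U" arbitrary: U rule: less_induct)
  case less
  show ?case
  proof (cases "U = F")
    case True
    then show ?thesis
      using submodule_F by (intro exI[of _ "[F]"]) simp
  next
    case False
    then obtain U' where U': "submodule U'" "covers U U'"
      using ex_cover less.prems by blast
    then have "codim F U' < codim F U"
      using codim_submodule_strict less.prems unfolding covers_def by blast
    then obtain Us where "Us \<noteq> []" "hd Us = U'" "last Us = F" "\<forall>U\<in>set Us. submodule U"
      "successively covers Us"
      using less.hyps U'(1) by blast
    then show ?thesis
      using U' less.prems by (intro exI[of _ "U # Us"]) (auto simp: successively_Cons)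
  qed
qed

text \<open>
  The Jordan-Hoelder argument. Intersecting a chain of submodules of \<open>N'\<close> with a maximal submodule
  \<open>N\<close> loses at most one member: the members inside \<open>N\<close> are unchanged, those outside \<open>N\<close> are
  determined by their intersection with \<open>N\<close> by the modular law (their sum with \<open>N\<close> is \<open>N'\<close>), and
  only the largest member inside \<open>N\<close> can also be the intersection of an outside member with \<open>N\<close>.
\<close>

lemma card_chain_Int_cover:
  assumes N: "submodule N" and N': "submodule N'" and cov: "covers N N'"
    and fin: "finite \<W>" and sub: "\<forall>W\<in>\<W>. submodule W \<and> W \<subseteq> N'"
    and chain: "\<forall>W\<in>\<W>. \<forall>W'\<in>\<W>. W \<subseteq> W' \<or> W' \<subseteq> W"
  shows "card \<W> \<le> Suc (card ((\<lambda>W. W \<inter> N) ` \<W>))"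
proof -
  let ?f = "\<lambda>W. W \<inter> N"
  define I where "I = {W\<in>\<W>. W \<subseteq> N}"
  define O' where "O' = {W\<in>\<W>. \<not> W \<subseteq> N}"
  have split: "\<W> = I \<union> O'" "I \<inter> O' = {}"
    unfolding I_def O'_def by auto
  have fin': "finite I" "finite O'"
    using fin unfolding I_def O'_def by auto
  have f_I: "?f W = W" if "W \<in> I" for W
    using that unfolding I_def by auto
  have sum_N': "N' \<subseteq> {x + y |x y. x \<in> W \<and> y \<in> N}" if "W \<in> O'" for W
  proof -
    let ?X = "{x + y |x y. x \<in> W \<and> y \<in> N}"
    have W: "submodule W" "W \<subseteq> N'" "\<not> W \<subseteq> N"
      using that sub unfolding O'_def by auto
    have "0 \<in> W" "0 \<in> N"
      using W(1) N submoduleD(1) subspace_0 by auto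
    then have "N \<subseteq> ?X" "W \<subseteq> ?X"
      by force+
    then have "N \<subset> ?X"
      using W(3) by blast
    moreover have "?X \<subseteq> N'"
      using W(2) cov subspace_add[OF submoduleD(1)[OF N']] unfolding covers_def by blast
    ultimately show ?thesis
      using submodule_sum[OF W(1) N] cov unfolding covers_def by blast
  qed
  have modular: "W' \<subseteq> W" if "W \<in> O'" "W' \<in> O'" "?f W = ?f W'" "W \<subseteq> W'" for W W'
  proof
    fix x assume x: "x \<in> W'"
    have W: "submodule W" "submodule W'" "W' \<subseteq> N'"
      using that sub unfolding O'_def by auto
    have "x \<in> {x + y |x y. x \<in> W \<and> y \<in> N}"
      using x W(3) sum_N'[OF that(1)] by blast
    then obtain a b where ab: "x = a + b" "a \<in> W" "b \<in> N"
      by blast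
    have "x - a \<in> W'"
      using subspace_diff[OF submoduleD(1)[OF W(2)]] x ab(2) that(4) by blast
    then have "b \<in> W"
      using ab that(3) by auto
    then show "x \<in> W"
      using ab subspace_add[OF submoduleD(1)[OF W(1)]] by blast
  qed
  have inj_O: "inj_on ?f O'"
  proof (rule inj_onI)
    fix W W' assume W: "W \<in> O'" "W' \<in> O'" "?f W = ?f W'"
    then have "W \<subseteq> W' \<or> W' \<subseteq> W"
      using chain unfolding O'_def by blast
    then show "W = W'"
      using modular[OF W] modular[OF W(2,1) W(3)[symmetric]] by blast
  qed
  have max: "W' \<subseteq> W" if "W \<in> ?f ` O'" "W' \<in> I" for W W'
  proof -
    have "W \<in> ?f ` O'"
      using that(1) .
    then obtain Y where Y: "Y \<in> O'" "W = Y \<inter> N"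
      by (elim imageE) simp
    have "\<not> Y \<subseteq> W'" "W' \<subseteq> N" "Y \<in> \<W>" "W' \<in> \<W>"
      using Y(1) that(2) unfolding I_def O'_def by auto
    moreover have "Y \<subseteq> W' \<or> W' \<subseteq> Y"
      using chain \<open>Y \<in> \<W>\<close> \<open>W' \<in> \<W>\<close> by simp
    ultimately show ?thesis
      using Y(2) by simp
  qed
  have f_image_I: "?f ` I = I"
    using image_cong[of I I ?f id] f_I by simp
  have "card (I \<inter> ?f ` O') \<le> 1"
  proof -
    have "is_singleton (I \<inter> ?f ` O') \<or> I \<inter> ?f ` O' = {}"
      unfolding is_singleton_iff_ex1
      by (metis Int_iff ex_in_conv max subset_antisym)
    then show ?thesis
      by (auto simp: is_singleton_altdef)
  qed
  then have "card (?f ` I \<inter> ?f ` O') \<le> 1"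
    unfolding f_image_I .
  moreover have "card (?f ` I) = card I"
    unfolding f_image_I ..
  moreover have "card (?f ` O') = card O'"
    by (rule card_image[OF inj_O])
  moreover have "card (?f ` I) + card (?f ` O') = card (?f ` I \<union> ?f ` O') + card (?f ` I \<inter> ?f ` O')"
    by (rule card_Un_Int) (use fin' in auto)
  moreover have "card \<W> = card I + card O'"
    using split fin' card_Un_disjoint by metis
  moreover have "?f ` \<W> = ?f ` I \<union> ?f ` O'"
    using split(1) by blast
  ultimately show ?thesis by simp
qed

text \<open>
  Applied along a composition series, this bounds the size of every chain of submodules. Since a
  composition series is itself a chain, all composition series have the same length, and the
  definite description in \<open>composition_length\<close> denotes it.
\<close>

lemma card_chain_le_series:
  assumes "Us \<noteq> []" "hd Us = R" "\<forall>U\<in>set Us. submodule U" "successively covers Us"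
    and "finite \<W>" "\<forall>W\<in>\<W>. submodule W \<and> W \<subseteq> last Us"
    and "\<forall>W\<in>\<W>. \<forall>W'\<in>\<W>. W \<subseteq> W' \<or> W' \<subseteq> W"
  shows "card \<W> \<le> length Us"
  using assms
proof (induction Us arbitrary: \<W> rule: rev_induct)
  case Nil
  then show ?case by simp
next
  case (snoc N' Us)
  show ?case
  proof (cases "Us = []")
    case True
    then have "\<W> \<subseteq> {R}"
      using snoc.prems submoduleD(2) by fastforce
    then have "card \<W> \<le> card {R}"
      by (intro card_mono) auto
    then show ?thesis
      using True by simp
  next
    case False
    let ?N = "last Us"
    have Us: "hd Us = R" "\<forall>U\<in>set Us. submodule U" "successively covers Us"
      using snoc.prems(2-4) False by (auto simp: successively_append_iff)
    have N: "submodule ?N" "submodule N'" "covers ?N N'"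
      using snoc.prems(3,4) False by (auto simp: successively_append_iff)
    have "card \<W> \<le> Suc (card ((\<lambda>W. W \<inter> ?N) ` \<W>))"
      using card_chain_Int_cover[OF N snoc.prems(5) _ snoc.prems(7)] snoc.prems(6) by simp
    also have "card ((\<lambda>W. W \<inter> ?N) ` \<W>) \<le> length Us"
    proof (rule snoc.IH)
      show "\<forall>W\<in>(\<lambda>W. W \<inter> ?N) ` \<W>. submodule W \<and> W \<subseteq> ?N"
        using snoc.prems(6) submodule_Int N(1) by blast
      show "\<forall>W\<in>(\<lambda>W. W \<inter> ?N) ` \<W>. \<forall>W'\<in>(\<lambda>W. W \<inter> ?N) ` \<W>. W \<subseteq> W' \<or> W' \<subseteq> W"
      proof (intro ballI, elim imageE)
        fix X X' W W'
        assume "W \<in> \<W>" "W' \<in> \<W>" and X: "X = W \<inter> ?N" "X' = W' \<inter> ?N"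
        then have "W \<subseteq> W' \<or> W' \<subseteq> W"
          using snoc.prems(7) by blast
        then show "X \<subseteq> X' \<or> X' \<subseteq> X"
          unfolding X by blast
      qed
      show "finite ((\<lambda>W. W \<inter> ?N) ` \<W>)"
        using snoc.prems(5) by simp
    qed (use Us False in blast)+
    finally show ?thesis by simp
  qed
qed

lemma series_is_chain:
  assumes "successively covers Us"
  shows "card (set Us) = length Us" "\<forall>W\<in>set Us. \<forall>W'\<in>set Us. W \<subseteq> W' \<or> W' \<subseteq> W"
proof -
  have "successively (\<subset>) Us"
    using assms unfolding successively_conv_nth covers_def by blast
  then have *: "sorted_wrt (\<subset>) Us"
    by (rule successively_conv_sorted_wrt[THEN iffD1, rotated]) (blast intro: transpI psubset_trans)
  have lt: "Us ! i \<subset> Us ! j" if "i < j" "j < length Us" for i j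
    using * that unfolding sorted_wrt_iff_nth_less by blast
  have "distinct Us"
    unfolding distinct_conv_nth
  proof (intro allI impI)
    fix i j assume "i < length Us" "j < length Us" "i \<noteq> j"
    then show "Us ! i \<noteq> Us ! j"
      using lt[of i j] lt[of j i] by (cases "i < j") auto
  qed
  then show "card (set Us) = length Us"
    by (rule distinct_card)
  show "\<forall>W\<in>set Us. \<forall>W'\<in>set Us. W \<subseteq> W' \<or> W' \<subseteq> W"
  proof (intro ballI)
    fix W W' assume "W \<in> set Us" "W' \<in> set Us"
    then obtain i j where "i < length Us" "W = Us ! i" "j < length Us" "W' = Us ! j"
      unfolding in_set_conv_nth by blast
    then show "W \<subseteq> W' \<or> W' \<subseteq> W"
      using lt[of i j] lt[of j i] by (cases i j rule: linorder_cases) auto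
  qed
qed

lemma composition_length_eq:
  assumes "composition_series scale S act F R Us"
  shows "Suc (composition_length scale S act F R) = length Us"
proof -
  have le: "length Vs \<le> length Us"
    if "composition_series scale S act F R Us" "composition_series scale S act F R Vs" for Us Vs
  proof -
    have "card (set Vs) \<le> length Us"
    proof (rule card_chain_le_series)
      show "\<forall>W\<in>set Vs. submodule W \<and> W \<subseteq> last Us"
        using that submoduleD(3) unfolding composition_series_iff by simp
      show "\<forall>W\<in>set Vs. \<forall>W'\<in>set Vs. W \<subseteq> W' \<or> W' \<subseteq> W"
        by (rule series_is_chain(2)) (use that(2) in \<open>simp add: composition_series_iff\<close>)
    qed (use that(1) in \<open>simp_all add: composition_series_iff\<close>)
    then show ?thesis
      using that(2) series_is_chain(1)[of Vs] unfolding composition_series_iff by simp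
  qed
  have "composition_length scale S act F R = length Us - 1"
    unfolding composition_length_def
  proof (rule the_equality)
    show "\<exists>Vs. composition_series scale S act F R Vs \<and> length Vs = Suc (length Us - 1)"
      using assms unfolding composition_series_iff by (intro exI[of _ Us]) auto
  next
    fix l assume "\<exists>Vs. composition_series scale S act F R Vs \<and> length Vs = Suc l"
    then show "l = length Us - 1"
      using le assms by (metis diff_Suc_1 le_antisym)
  qed
  then show ?thesis
    using assms unfolding composition_series_iff by auto
qed

lemma card_chain_le_composition_length:
  assumes "finite \<W>" "\<forall>W\<in>\<W>. submodule W" "\<forall>W\<in>\<W>. \<forall>W'\<in>\<W>. W \<subseteq> W' \<or> W' \<subseteq> W"
  shows "card \<W> \<le> Suc (composition_length scale S act F R)"
proof -
  obtain Us where Us: "composition_series scale S act F R Us"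
    using composition_series_from[OF submodule_R] unfolding composition_series_iff by blast
  then show ?thesis
    using card_chain_le_series[OF _ _ _ _ assms(1) _ assms(3), of Us] assms(2) submoduleD(3)
      composition_length_eq[OF Us]
    unfolding composition_series_iff by simp
qed

lemma composition_length_le_codim: "composition_length scale S act F R \<le> codim F R"
proof -
  obtain Us where Us: "composition_series scale S act F R Us"
    using composition_series_from[OF submodule_R] unfolding composition_series_iff by blast
  then have succ: "successively covers Us" and sub: "\<forall>U\<in>set Us. submodule U"
    unfolding composition_series_iff by simp_all
  note card = series_is_chain(1)[OF succ] and chain = series_is_chain(2)[OF succ]
  have "inj_on (codim F) (set Us)"
  proof (rule inj_onI)
    fix W W' assume "W \<in> set Us" "W' \<in> set Us" and eq: "codim F W = codim F W'"
    then have "submodule W" "submodule W'" and le: "W \<subseteq> W' \<or> W' \<subseteq> W"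
      using sub chain by simp_all
    then have "\<not> W \<subset> W'" "\<not> W' \<subset> W"
      using codim_submodule_strict[of W W'] codim_submodule_strict[of W' W] eq by auto
    with le show "W = W'" by auto
  qed
  then have "length Us = card (codim F ` set Us)"
    using card by (simp add: card_image)
  also have "codim F ` set Us \<subseteq> {..codim F R}"
  proof clarsimp
    fix U assume "U \<in> set Us"
    then have "submodule U"
      using sub by simp
    then have "R \<subseteq> U" "R \<subset> U \<Longrightarrow> codim F U < codim F R"
      using codim_submodule_strict[OF submodule_R] submoduleD(2) by auto
    then show "codim F U \<le> codim F R"
      by (cases "R = U") (auto simp: psubset_eq)
  qed
  then have "card (codim F ` set Us) \<le> card {..codim F R}"
    by (intro card_mono) auto
  finally show ?thesis
    using composition_length_eq[OF Us] by simp
qed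

end


section \<open>Common eigenvectors\<close>

locale alg_closed_operator_module = operator_module scale S act F R
  for scale :: "'k::alg_closed_field \<Rightarrow> 'w::ab_group_add \<Rightarrow> 'w"
    and S :: "'a set" and act :: "'a \<Rightarrow> 'w \<Rightarrow> 'w" and F R :: "'w set"
begin

text \<open>The value \<open>p(A) w\<close> of a polynomial in the operator \<open>A\<close>, in Horner form.\<close>

definition poly_op :: "('w \<Rightarrow> 'w) \<Rightarrow> 'w \<Rightarrow> 'k poly \<Rightarrow> 'w" where
  "poly_op A w p = fold_coeffs (\<lambda>a x. scale a w + A x) p 0"

context
  fixes A and w :: 'w
  assumes lin: "Vector_Spaces.linear scale scale A"
begin

lemma op_simps: "A 0 = 0" "A (x + y) = A x + A y" "A (scale c x) = scale c (A x)"
proof -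
  show "A (x + y) = A x + A y" "A (scale c x) = scale c (A x)" for x y c
    using lin by (auto simp: Vector_Spaces.linear_iff)
  from this(2)[of 0 0] show "A 0 = 0"
    by simp
qed

lemma poly_op_0: "poly_op A w 0 = 0"
  by (simp add: poly_op_def)

lemma poly_op_pCons: "poly_op A w (pCons a p) = scale a w + A (poly_op A w p)"
  by (cases "a = 0 \<and> p = 0") (auto simp: poly_op_def op_simps)

lemma poly_op_add: "poly_op A w (p + q) = poly_op A w p + poly_op A w q"
  by (induction p q rule: poly_induct2)
    (simp_all add: poly_op_0 poly_op_pCons op_simps scale_left_distrib)

lemma poly_op_smult: "poly_op A w (smult c p) = scale c (poly_op A w p)"
  by (induction p) (simp_all add: poly_op_0 poly_op_pCons op_simps scale_right_distrib)

lemma poly_op_linear_factor: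
  "poly_op A w ([:- z, 1:] * p) = A (poly_op A w p) - scale z (poly_op A w p)"
proof -
  have "[:- z, 1:] * p = pCons 0 p + smult (- z) p"
    by simp
  then show ?thesis
    by (simp only: poly_op_add poly_op_smult poly_op_pCons) simp
qed

lemma poly_op_closed: "subspace U \<Longrightarrow> A ` U \<subseteq> U \<Longrightarrow> w \<in> U \<Longrightarrow> poly_op A w p \<in> U"
  by (induction p) (auto simp: poly_op_0 poly_op_pCons subspace_0 subspace_add subspace_scale)

text \<open>
  Otherwise the powers of \<open>A\<close> applied to \<open>w\<close> would be linearly independent modulo \<open>U\<close>, and
  adjoining them one by one would lower the codimension of \<open>U\<close> forever.
\<close>

lemma ex_annihilating_poly:
  assumes U: "subspace U" "U \<subseteq> F" "finite_codim F U"
    and F: "A ` F \<subseteq> F" "w \<in> F"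
  shows "\<exists>p. p \<noteq> 0 \<and> poly_op A w p \<in> U"
proof (rule ccontr)
  assume neg: "\<not> ?thesis"
  define K where "K j = span (U \<union> (\<lambda>i. poly_op A w (monom 1 i)) ` {..<j})" for j :: nat
  have poly_of_K: "\<exists>q. (\<forall>i\<ge>j. coeff q i = 0) \<and> x - poly_op A w q \<in> U" if "x \<in> K j" for x j
    using that unfolding K_def
  proof (induction rule: span_induct_alt)
    case base
    then show ?case
      using U(1) by (intro exI[of _ 0]) (simp add: poly_op_0 subspace_0)
  next
    case (step c x y)
    then obtain q where q: "\<forall>i\<ge>j. coeff q i = 0" "y - poly_op A w q \<in> U" by blast
    from step(1) show ?case
    proof
      assume "x \<in> U"
      then have "scale c x + (y - poly_op A w q) \<in> U"
        using U(1) q(2) by (simp add: subspace_add subspace_scale)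
      then show ?thesis
        using q(1) by (intro exI[of _ q]) (simp add: algebra_simps)
    next
      assume "x \<in> (\<lambda>i. poly_op A w (monom 1 i)) ` {..<j}"
      then obtain i where i: "i < j" "x = poly_op A w (monom 1 i)" by blast
      then show ?thesis
        using q
        by (intro exI[of _ "smult c (monom 1 i) + q"]) (simp add: poly_op_add poly_op_smult algebra_simps)
    qed
  qed
  have power_notin: "poly_op A w (monom 1 j) \<notin> K j" for j
  proof
    assume "poly_op A w (monom 1 j) \<in> K j"
    then obtain q where q: "\<forall>i\<ge>j. coeff q i = 0" "poly_op A w (monom 1 j) - poly_op A w q \<in> U"
      using poly_of_K by blast
    have "coeff (monom 1 j - q) j = 1"
      using q(1) by simp
    then have "monom 1 j - q \<noteq> 0"
      by fastforce
    moreover have "poly_op A w (monom 1 j - q) = poly_op A w (monom 1 j) - poly_op A w q"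
      using poly_op_add[of "monom 1 j - q" q] by simp
    ultimately show False
      using neg q(2) by metis
  qed
  have K_F: "K j \<subseteq> F" for j
    unfolding K_def
    by (rule span_minimal[OF _ subspace_F]) (use U(2) F poly_op_closed[OF subspace_F F] in auto)
  have "codim F (K j) + j \<le> codim F U" for j
  proof (induction j)
    case 0
    have "span U = U"
      using U(1) span_eq_iff by blast
    then show ?case
      by (simp add: K_def del: span_eq_iff)
  next
    case (Suc j)
    have "K j \<subseteq> K (Suc j)"
      unfolding K_def by (rule span_mono) auto
    moreover have "poly_op A w (monom 1 j) \<in> K (Suc j)"
      unfolding K_def by (rule span_base) auto
    ultimately have "K j \<subset> K (Suc j)"
      using power_notin by blast
    moreover have "finite_codim F (K j)"
      by (rule finite_codim_mono[OF U(3)]) (auto simp: K_def intro: span_base)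
    ultimately have "codim F (K (Suc j)) < codim F (K j)"
      using codim_strict_antimono K_F by (simp add: K_def)
    with Suc show ?case by simp
  qed
  from this[of "Suc (codim F U)"] show False by simp
qed

text \<open>
  Take an annihilating polynomial of \<open>w\<close> modulo \<open>U\<close> of least degree and split off a linear factor:
  the cofactor, applied to \<open>w\<close>, is an eigenvector modulo \<open>U\<close>.
\<close>

lemma ex_eigenvector_mod:
  assumes U: "subspace U" "finite_codim F U" and U': "subspace U'" "U \<subseteq> U'" "U' \<subseteq> F"
    and inv: "A ` U' \<subseteq> U'" "A ` F \<subseteq> F" and w: "w \<in> U'" "w \<notin> U"
  shows "\<exists>v z. v \<in> U' \<and> v \<notin> U \<and> A v - scale z v \<in> U"
proof -
  define P where "P p \<longleftrightarrow> p \<noteq> 0 \<and> poly_op A w p \<in> U" for p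
  have "\<exists>p. P p"
    using ex_annihilating_poly[OF U(1) _ U(2) inv(2)] U' w unfolding P_def by blast
  then obtain p where p: "P p" and min: "\<And>q. P q \<Longrightarrow> degree p \<le> degree q"
    using ex_has_least_nat[of P _ degree] by blast
  have "degree p > 0"
  proof (rule ccontr)
    assume "\<not> degree p > 0"
    then obtain c where c: "p = [:c:]"
      by (metis degree_eq_zeroE not_gr_zero)
    then have "scale c w \<in> U" "c \<noteq> 0"
      using p unfolding P_def by (auto simp: poly_op_pCons poly_op_0 op_simps)
    then have "scale (inverse c) (scale c w) \<in> U"
      using U(1) subspace_scale by blast
    then show False
      using \<open>c \<noteq> 0\<close> w(2) by simp
  qed
  then obtain z where "poly p z = 0"
    using alg_closed_imp_poly_has_root by blast
  then obtain q where q: "p = [:- z, 1:] * q"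
    by (auto simp: poly_eq_0_iff_dvd elim: dvdE)
  then have "q \<noteq> 0"
    using p unfolding P_def by auto
  then have "degree p = Suc (degree q)"
    unfolding q by (subst degree_mult_eq) auto
  then have "\<not> P q"
    using min by fastforce
  then have "poly_op A w q \<notin> U"
    using \<open>q \<noteq> 0\<close> unfolding P_def by blast
  moreover have "poly_op A w q \<in> U'"
    using poly_op_closed U'(1) inv(1) w(1) by blast
  moreover have "A (poly_op A w q) - scale z (poly_op A w q) \<in> U"
    using p poly_op_linear_factor[of z q] unfolding P_def q by simp
  ultimately show ?thesis by blast
qed

end

text \<open>
  From here on the operators commute modulo the submodule \<open>W\<close>, so they induce commuting operators on
  all subquotients above \<open>W\<close>.
\<close>

context
  fixes W :: "'w set"
  assumes W: "submodule W"
    and comm: "\<lbrakk>g \<in> S; h \<in> S; f \<in> F\<rbrakk> \<Longrightarrow> act g (act h f) - act h (act g f) \<in> W"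
begin

text \<open>
  Schur's lemma: the eigenspace of an eigenvalue of \<open>act g\<close> on a simple factor \<open>U' / U\<close> is a
  submodule because the operators commute modulo \<open>W \<subseteq> U\<close>, hence it is everything.
\<close>

lemma scalar_on_cover:
  assumes U: "submodule U" "W \<subseteq> U" and U': "submodule U'" "covers U U'" and g: "g \<in> S"
  shows "\<exists>z. \<forall>u\<in>U'. act g u - scale z u \<in> U"
proof -
  obtain w where w: "w \<in> U'" "w \<notin> U"
    using U'(2) unfolding covers_def by blast
  have "U \<subseteq> U'"
    using U'(2) unfolding covers_def by blast
  then obtain v z where v: "v \<in> U'" "v \<notin> U" "act g v - scale z v \<in> U"
    using ex_eigenvector_mod[OF act_linear[OF g] submoduleD(1)[OF U(1)] finite_codim_submodule[OF U(1)]
        submoduleD(1)[OF U'(1)] _ submoduleD(3)[OF U'(1)] _ act_F[OF g] w]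
      submoduleD(4)[OF U'(1) g] by blast
  define E where "E = {u\<in>U'. act g u - scale z u \<in> U}"
  have lin: "act h (x + y) = act h x + act h y" "act h (scale c x) = scale c (act h x)" if "h \<in> S" for h x y c
    using act_linear[OF that] by (auto simp: Vector_Spaces.linear_iff)
  have diff: "act h (x - y) = act h x - act h y" if "h \<in> S" for h x y
    using lin(1)[OF that, of "x - y" y] by (simp add: algebra_simps)
  note sU = submoduleD(1)[OF U(1)] and sU' = submoduleD(1)[OF U'(1)]
  have U_E: "U \<subseteq> E"
    using \<open>U \<subseteq> U'\<close> submoduleD(4)[OF U(1) g] sU subspace_diff subspace_scale unfolding E_def by blast
  have "submodule E"
    unfolding quotient_submodule_def
  proof (intro conjI ballI)
    have "act g 0 = 0"
      using lin(2)[OF g, of 0 0] by simp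
    moreover have "act g (x + y) - scale z (x + y) = (act g x - scale z x) + (act g y - scale z y)" for x y
      by (simp add: lin(1)[OF g] scale_right_distrib)
    moreover have "act g (scale c x) - scale z (scale c x) = scale c (act g x - scale z x)" for c x
      by (simp add: lin(2)[OF g] scale_right_diff_distrib mult.commute)
    ultimately show "subspace E"
      unfolding subspace_def E_def using sU sU' by (auto simp: subspace_def)
    show "R \<subseteq> E"
      using U_E submoduleD(2)[OF U(1)] by blast
    show "E \<subseteq> F"
      unfolding E_def using submoduleD(3)[OF U'(1)] by blast
  next
    fix h assume h: "h \<in> S"
    show "act h ` E \<subseteq> E"
    proof
      fix x assume "x \<in> act h ` E"
      then obtain u where u: "u \<in> U'" "act g u - scale z u \<in> U" "x = act h u"
        unfolding E_def by blast
      have "act h (act g u - scale z u) \<in> U"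
        using submoduleD(4)[OF U(1) h] u(2) .
      moreover have "act g (act h u) - act h (act g u) \<in> U"
        using comm[OF g h] u(1) submoduleD(3)[OF U'(1)] U(2) by blast
      ultimately have "(act g (act h u) - act h (act g u)) + act h (act g u - scale z u) \<in> U"
        using sU subspace_add by blast
      then have "act g x - scale z x \<in> U"
        unfolding u(3) by (simp add: diff[OF h] lin(2)[OF h])
      moreover have "x \<in> U'"
        using submoduleD(4)[OF U'(1) h] u by blast
      ultimately show "x \<in> E"
        unfolding E_def by blast
    qed
  qed
  moreover have "U \<subset> E"
    using U_E v unfolding E_def by blast
  moreover have "E \<subseteq> U'"
    unfolding E_def by blast
  ultimately have "E = U'"
    using U'(2) unfolding covers_def by blast
  then show ?thesis
    unfolding E_def by blast
qed

text \<open>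
  On a minimal submodule \<open>U' / U\<close> all operators are scalars, so any line in it is a submodule.
\<close>

lemma ex_line_above:
  assumes U: "submodule U" "W \<subseteq> U" "U \<noteq> F"
  obtains w where "w \<notin> U" "submodule (span (insert w U))"
proof -
  obtain U' where U': "submodule U'" "covers U U'"
    using ex_cover U by blast
  then obtain w where w: "w \<in> U'" "w \<notin> U" and "U \<subseteq> U'"
    unfolding covers_def by blast
  let ?L = "span (insert w U)"
  have "submodule ?L"
    unfolding quotient_submodule_def
  proof (intro conjI ballI)
    show "R \<subseteq> ?L"
      using submoduleD(2)[OF U(1)] span_superset by blast
    show "?L \<subseteq> F"
      by (rule span_minimal[OF _ subspace_F])
        (use w \<open>U \<subseteq> U'\<close> submoduleD(3)[OF U'(1)] in auto)
  next
    fix g assume g: "g \<in> S"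
    obtain z where z: "\<And>u. u \<in> U' \<Longrightarrow> act g u - scale z u \<in> U"
      using scalar_on_cover[OF U(1,2) U' g] by blast
    have "act g x \<in> ?L" if "x \<in> insert w U" for x
    proof -
      have "x \<in> U'"
        using that w \<open>U \<subseteq> U'\<close> by auto
      then have "act g x - scale z x \<in> ?L"
        using z by (simp add: span_base)
      then have "(act g x - scale z x) + scale z x \<in> ?L"
        using that by (intro span_add span_scale) (simp_all add: span_base)
      then show ?thesis by simp
    qed
    then have "act g ` insert w U \<subseteq> ?L"
      by blast
    then have "span (act g ` insert w U) \<subseteq> ?L"
      by (rule span_minimal) (rule subspace_span)
    then show "act g ` ?L \<subseteq> ?L"
      using module_hom.span_image[of scale scale "act g" "insert w U"] act_linear[OF g]
      by (simp add: linear_iff_module_hom)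
  qed auto
  with w show thesis using that by blast
qed

lemma ex_chain_above:
  assumes "submodule U" "W \<subseteq> U"
  shows "\<exists>\<W>. finite \<W> \<and> (\<forall>X\<in>\<W>. submodule X \<and> U \<subseteq> X) \<and>
    (\<forall>X\<in>\<W>. \<forall>X'\<in>\<W>. X \<subseteq> X' \<or> X' \<subseteq> X) \<and> codim F U < card \<W>"
  using assms
proof (induction "codim F U" arbitrary: U rule: less_induct)
  case less
  show ?case
  proof (cases "U = F")
    case True
    then have "codim F U = 0"
      using codim_le[of "{}" F U] span_superset by auto
    then show ?thesis
      using less.prems by (intro exI[of _ "{U}"]) auto
  next
    case False
    then obtain w where w: "w \<notin> U" "submodule (span (insert w U))"
      using ex_line_above less.prems by blast
    let ?L = "span (insert w U)"
    have UL: "U \<subset> ?L"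
      using w(1) span_superset[of "insert w U"] by blast
    have "codim F ?L < codim F U"
      using codim_submodule_strict less.prems(1) w(2) UL by blast
    moreover have "W \<subseteq> ?L"
      using UL less.prems(2) by blast
    ultimately obtain \<W> where \<W>: "finite \<W>" "\<forall>X\<in>\<W>. submodule X \<and> ?L \<subseteq> X"
      "\<forall>X\<in>\<W>. \<forall>X'\<in>\<W>. X \<subseteq> X' \<or> X' \<subseteq> X" "codim F ?L < card \<W>"
      using less.hyps w(2) by metis
    have "U \<notin> \<W>"
      using \<W>(2) UL by auto
    moreover have "codim F U \<le> Suc (codim F ?L)"
      using codim_le_add[OF finite_codim_submodule[OF w(2)], of "{w}" U] by simp
    ultimately have "codim F U < card (insert U \<W>)"
      using \<W>(1,4) by simp
    moreover have above: "U \<subseteq> X" if "X \<in> \<W>" for X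
      using \<W>(2) that UL by (meson order_trans psubset_imp_subset)
    moreover have "\<forall>X\<in>insert U \<W>. \<forall>X'\<in>insert U \<W>. X \<subseteq> X' \<or> X' \<subseteq> X"
      using \<W>(3) above by simp
    moreover have "\<forall>X\<in>insert U \<W>. submodule X \<and> U \<subseteq> X"
      using \<W>(2) above less.prems(1) by simp
    ultimately show ?thesis
      using \<W>(1) by (intro exI[of _ "insert U \<W>"] conjI) simp_all
  qed
qed

text \<open>
  Adding one line at a time gives a flag of submodules from \<open>W\<close> up to \<open>F\<close>, so \<open>F / W\<close> contributes its
  full dimension to the length.
\<close>

lemma codim_le_composition_length: "codim F W \<le> composition_length scale S act F R"
proof -
  obtain \<W> where \<W>: "finite \<W>" "\<forall>X\<in>\<W>. submodule X \<and> W \<subseteq> X"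
    "\<forall>X\<in>\<W>. \<forall>X'\<in>\<W>. X \<subseteq> X' \<or> X' \<subseteq> X" "codim F W < card \<W>"
    using ex_chain_above[OF W order_refl] by blast
  have "card \<W> \<le> Suc (composition_length scale S act F R)"
    by (rule card_chain_le_composition_length) (use \<W> in simp_all)
  with \<W>(4) show ?thesis by simp
qed

end

end


section \<open>Tensor powers\<close>

lemma lookup_free_scale [simp]: "Poly_Mapping.lookup (free_scale c f) x = c * Poly_Mapping.lookup f x"
  unfolding free_scale_def by (simp add: map.rep_eq when_def)

interpretation free: ambient_space "free_scale :: 'k::field \<Rightarrow> ('x \<Rightarrow>\<^sub>0 'k) \<Rightarrow> ('x \<Rightarrow>\<^sub>0 'k)"
  by unfold_locales (auto intro!: poly_mapping_eqI simp: lookup_add algebra_simps)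

abbreviation unit_vec :: "'x \<Rightarrow> ('x \<Rightarrow>\<^sub>0 'k::field)" where
  "unit_vec x \<equiv> Poly_Mapping.single x 1"

lemma free_scale_unit_vec: "free_scale c (unit_vec x) = Poly_Mapping.single x c"
  by (rule poly_mapping_eqI) (simp add: lookup_single when_def)

definition lin_ext :: "('x \<Rightarrow> ('y \<Rightarrow>\<^sub>0 'k::field)) \<Rightarrow> ('x \<Rightarrow>\<^sub>0 'k) \<Rightarrow> ('y \<Rightarrow>\<^sub>0 'k)" where
  "lin_ext \<phi> f = (\<Sum>x\<in>Poly_Mapping.keys f. free_scale (Poly_Mapping.lookup f x) (\<phi> x))"

lemma lin_ext_superset:
  assumes "finite X" "Poly_Mapping.keys f \<subseteq> X"
  shows "lin_ext \<phi> f = (\<Sum>x\<in>X. free_scale (Poly_Mapping.lookup f x) (\<phi> x))"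
  unfolding lin_ext_def
  by (rule sum.mono_neutral_left) (use assms in \<open>auto simp: in_keys_iff\<close>)

lemma lin_ext_unit_vec [simp]: "lin_ext \<phi> (unit_vec x) = \<phi> x"
  by (simp add: lin_ext_def)

lemma lin_ext_linear: "Vector_Spaces.linear free_scale free_scale (lin_ext \<phi>)"
proof -
  have "lin_ext \<phi> (f + g) = lin_ext \<phi> f + lin_ext \<phi> g" for f g
  proof -
    let ?X = "Poly_Mapping.keys f \<union> Poly_Mapping.keys g"
    have "lin_ext \<phi> (f + g) = (\<Sum>x\<in>?X. free_scale (Poly_Mapping.lookup (f + g) x) (\<phi> x))"
      by (rule lin_ext_superset) (auto dest: Poly_Mapping.keys_add[THEN subsetD])
    also have "\<dots> = lin_ext \<phi> f + lin_ext \<phi> g"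
      by (simp add: lookup_add free.scale_left_distrib sum.distrib lin_ext_superset[of ?X])
    finally show ?thesis .
  qed
  moreover have "lin_ext \<phi> (free_scale c f) = free_scale c (lin_ext \<phi> f)" for c f
  proof -
    have "lin_ext \<phi> (free_scale c f) =
        (\<Sum>x\<in>Poly_Mapping.keys f. free_scale (Poly_Mapping.lookup (free_scale c f) x) (\<phi> x))"
      by (rule lin_ext_superset) (auto simp: in_keys_iff)
    then show ?thesis
      by (simp add: lin_ext_def free.scale_sum_right)
  qed
  ultimately show ?thesis
    by (simp add: Vector_Spaces.linear_iff free.vector_space_axioms)
qed

lemma lin_ext_simps:
  "lin_ext \<phi> 0 = 0" "lin_ext \<phi> (f + g) = lin_ext \<phi> f + lin_ext \<phi> g"
  "lin_ext \<phi> (f - g) = lin_ext \<phi> f - lin_ext \<phi> g"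
  "lin_ext \<phi> (free_scale c f) = free_scale c (lin_ext \<phi> f)"
proof -
  show add: "lin_ext \<phi> (f + g) = lin_ext \<phi> f + lin_ext \<phi> g" for f g
    using lin_ext_linear[of \<phi>] by (simp add: Vector_Spaces.linear_iff)
  show "lin_ext \<phi> (free_scale c f) = free_scale c (lin_ext \<phi> f)"
    using lin_ext_linear[of \<phi>] by (simp add: Vector_Spaces.linear_iff)
  show "lin_ext \<phi> 0 = 0"
    by (simp add: lin_ext_def)
  show "lin_ext \<phi> (f - g) = lin_ext \<phi> f - lin_ext \<phi> g"
    using add[of "f - g" g] by (simp add: algebra_simps)
qed

lemma lin_ext_span:
  assumes "f \<in> free.span X" "\<And>x. x \<in> X \<Longrightarrow> lin_ext \<phi> x \<in> free.span Y"
  shows "lin_ext \<phi> f \<in> free.span Y"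
  using assms(1)
  by (induction rule: free.span_induct_alt)
    (auto simp: lin_ext_simps free.span_zero intro: free.span_add free.span_scale assms(2))

lemma in_span_unit_vecs: "f \<in> free.span (unit_vec ` Poly_Mapping.keys f)"
proof -
  have "f = lin_ext unit_vec f"
    by (rule poly_mapping_eqI)
      (auto simp: lin_ext_def free_scale_unit_vec lookup_sum lookup_single when_def in_keys_iff)
  also have "\<dots> \<in> free.span (unit_vec ` Poly_Mapping.keys f)"
    unfolding lin_ext_def by (intro free.span_sum free.span_scale free.span_base) auto
  finally show ?thesis .
qed

text \<open>The functions that vanish at \<open>x\<close> form a subspace, which contains all other unit vectors.\<close>

lemma independent_unit_vecs: "\<not> free.dependent ((unit_vec :: 'x \<Rightarrow> 'x \<Rightarrow>\<^sub>0 'k::field) ` X)"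
proof
  let ?u = "unit_vec :: 'x \<Rightarrow> 'x \<Rightarrow>\<^sub>0 'k"
  assume "free.dependent (?u ` X)"
  then obtain x where x: "x \<in> X" "?u x \<in> free.span (?u ` X - {?u x})"
    unfolding free.dependent_def by blast
  have "Poly_Mapping.lookup f x = 0" if "f \<in> free.span (?u ` X - {?u x})" for f
    using that
    by (induction rule: free.span_induct_alt) (auto simp: lookup_add lookup_single when_def split: if_splits)
  from this[OF x(2)] show False
    by simp
qed

lemma inj_unit_vec: "inj (unit_vec :: 'x \<Rightarrow> 'x \<Rightarrow>\<^sub>0 'k::field)"
  by (rule injI) (metis lookup_single_eq lookup_single_not_eq zero_neq_one)

lemma free_tuples_iff: "f \<in> free_tuples n \<longleftrightarrow> (\<forall>vs. length vs \<noteq> n \<longrightarrow> Poly_Mapping.lookup f vs = 0)"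
  unfolding free_tuples_def by (auto simp: in_keys_iff)

lemma subspace_free_tuples: "free.subspace (free_tuples n)"
  unfolding free.subspace_def by (simp add: free_tuples_iff lookup_add)

lemma free_tuples_eq_span: "(free_tuples n :: ('a list \<Rightarrow>\<^sub>0 'b::field) set) = free.span (unit_vec ` {vs. length vs = n})"
proof
  show "(free_tuples n :: ('a list \<Rightarrow>\<^sub>0 'b) set) \<subseteq> free.span (unit_vec ` {vs. length vs = n})"
  proof
    fix f :: "'a list \<Rightarrow>\<^sub>0 'b" assume "f \<in> free_tuples n"
    then have "unit_vec ` Poly_Mapping.keys f \<subseteq> unit_vec ` {vs. length vs = n}"
      unfolding free_tuples_def by (intro image_mono) simp
    from free.span_mono[OF this] show "f \<in> free.span (unit_vec ` {vs. length vs = n})"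
      using in_span_unit_vecs[of f] by (rule subsetD)
  qed
  show "free.span (unit_vec ` {vs. length vs = n}) \<subseteq> (free_tuples n :: ('a list \<Rightarrow>\<^sub>0 'b) set)"
    by (rule free.span_minimal[OF _ subspace_free_tuples])
      (auto simp: free_tuples_iff lookup_single when_def)
qed

lemma diagonal_action_eq_lin_ext: "diagonal_action \<rho> g = lin_ext (\<lambda>vs. unit_vec (map (\<rho> g) vs))"
  by (rule ext) (simp add: diagonal_action_def lin_ext_def free_scale_unit_vec)

lemma diagonal_action_linear: "Vector_Spaces.linear free_scale free_scale (diagonal_action \<rho> g)"
  by (simp add: diagonal_action_eq_lin_ext lin_ext_linear)

lemma diagonal_action_free_tuples:
  fixes \<rho> :: "'a \<Rightarrow> 'v \<Rightarrow> 'v"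
  shows "diagonal_action \<rho> g ` (free_tuples n :: ('v list \<Rightarrow>\<^sub>0 'k::field) set) \<subseteq> free_tuples n"
  unfolding free_tuples_eq_span diagonal_action_eq_lin_ext
proof clarify
  fix f :: "'v list \<Rightarrow>\<^sub>0 'k" assume "f \<in> free.span (unit_vec ` {vs. length vs = n})"
  then show "lin_ext (\<lambda>vs. unit_vec (map (\<rho> g) vs)) f \<in> free.span (unit_vec ` {vs. length vs = n})"
    by (rule lin_ext_span) (auto intro: free.span_base)
qed

lemma diagonal_action_comp:
  assumes "\<rho> g \<circ> \<rho> h = \<rho> g' \<circ> \<rho> h'"
  shows "diagonal_action \<rho> g (diagonal_action \<rho> h f) = diagonal_action \<rho> g' (diagonal_action \<rho> h' f)"
  using in_span_unit_vecs[of f]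
proof (induction rule: free.span_induct_alt)
  case base
  show ?case by (simp add: diagonal_action_eq_lin_ext lin_ext_simps)
next
  case (step c x y)
  then show ?case
    using assms by (auto simp: diagonal_action_eq_lin_ext lin_ext_simps)
qed

lemma diagonal_action_factor:
  assumes "\<rho> g = \<rho> x \<circ> \<rho> y" "f \<in> free_tuples n"
  shows "diagonal_action \<rho> g f \<in> diagonal_action \<rho> x ` free_tuples n"
proof -
  have "diagonal_action \<rho> g f = diagonal_action \<rho> x (diagonal_action \<rho> y f)"
    using in_span_unit_vecs[of f] assms(1)
    by (induction rule: free.span_induct_alt) (auto simp: diagonal_action_eq_lin_ext lin_ext_simps)
  moreover have "diagonal_action \<rho> y f \<in> free_tuples n"
    using diagonal_action_free_tuples assms(2) by (rule subsetD[OF _ imageI])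
  ultimately show ?thesis
    by (rule image_eqI)
qed

locale tensor_powers = vector_space scale
  for scale :: "'k::field \<Rightarrow> 'v::ab_group_add \<Rightarrow> 'v"
begin

abbreviation tuples :: "'v set \<Rightarrow> nat \<Rightarrow> ('v list \<Rightarrow>\<^sub>0 'k) set" where
  "tuples C n \<equiv> unit_vec ` {vs. set vs \<subseteq> C \<and> length vs = n}"

lemma card_tuples:
  assumes "finite C"
  shows "finite (tuples C n)" "card (tuples C n) = card C ^ n"
proof -
  show "finite (tuples C n)"
    using finite_lists_length_eq[OF assms] by (rule finite_imageI)
  have "card (tuples C n) = card {vs. set vs \<subseteq> C \<and> length vs = n}"
    by (rule card_image) (rule inj_on_subset[OF inj_unit_vec], simp)
  then show "card (tuples C n) = card C ^ n"
    by (simp add: card_lists_length_eq[OF assms])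
qed

lemma relatorI:
  assumes "length us + 1 + length ws = n"
  shows "unit_vec (us @ (a + b) # ws) - unit_vec (us @ a # ws) - unit_vec (us @ b # ws)
      \<in> multilinear_relators scale n"
    and "unit_vec (us @ scale c a # ws) - free_scale c (unit_vec (us @ a # ws))
      \<in> multilinear_relators scale n"
  unfolding multilinear_relators_def using assms by blast+

lemma relators_in_tensor_relations: "f \<in> multilinear_relators scale n \<Longrightarrow> f \<in> tensor_relations scale n"
  unfolding tensor_relations_def by (rule free.span_base)

lemma subspace_tensor_relations: "free.subspace (tensor_relations scale n)"
  unfolding tensor_relations_def by (rule free.subspace_span)

lemma tensor_relations_le: "tensor_relations scale n \<subseteq> free_tuples n"
  unfolding tensor_relations_def
proof (rule free.span_minimal[OF _ subspace_free_tuples])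
  have unit: "unit_vec vs \<in> free_tuples l" if "length vs = l" for vs :: "'v list" and l
    using that by (simp add: free_tuples_def)
  show "multilinear_relators scale n \<subseteq> free_tuples n"
    unfolding multilinear_relators_def
    by (auto intro!: free.subspace_diff[OF subspace_free_tuples]
        free.subspace_scale[OF subspace_free_tuples] unit)
qed

lemma diagonal_action_tensor_relations:
  assumes "Vector_Spaces.linear scale scale (\<rho> g)"
  shows "diagonal_action \<rho> g ` tensor_relations scale n \<subseteq> tensor_relations scale n"
proof -
  have lin: "\<rho> g (a + b) = \<rho> g a + \<rho> g b" "\<rho> g (scale c a) = scale c (\<rho> g a)" for a b c
    using assms by (auto simp: Vector_Spaces.linear_iff)
  have "diagonal_action \<rho> g f \<in> multilinear_relators scale n"
    if rel: "f \<in> multilinear_relators scale n" for f :: "'v list \<Rightarrow>\<^sub>0 'k"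
  proof -
    consider (add) us a b ws where "length us + 1 + length ws = n"
        "f = unit_vec (us @ (a + b) # ws) - unit_vec (us @ a # ws) - unit_vec (us @ b # ws)"
      | (scale) us c a ws where "length us + 1 + length ws = n"
        "f = unit_vec (us @ scale c a # ws) - free_scale c (unit_vec (us @ a # ws))"
      using rel unfolding multilinear_relators_def by blast
    then show ?thesis
    proof cases
      case add
      then show ?thesis
        using relatorI(1)[of "map (\<rho> g) us" "map (\<rho> g) ws"]
        by (simp add: diagonal_action_eq_lin_ext lin_ext_simps lin)
    next
      case scale
      then show ?thesis
        using relatorI(2)[of "map (\<rho> g) us" "map (\<rho> g) ws"]
        by (simp add: diagonal_action_eq_lin_ext lin_ext_simps lin)
    qed
  qed
  note relators = free.span_base[OF this]
  show ?thesis
    unfolding tensor_relations_def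
  proof (rule image_subsetI)
    fix f :: "'v list \<Rightarrow>\<^sub>0 'k" assume "f \<in> free.span (multilinear_relators scale n)"
    then show "diagonal_action \<rho> g f \<in> free.span (multilinear_relators scale n)"
      using relators unfolding diagonal_action_eq_lin_ext by (rule lin_ext_span)
  qed
qed

text \<open>Multilinear expansion, one tensor factor after the other.\<close>

lemma tensor_expansion:
  assumes "set vs \<subseteq> span C" "length vs = n"
  shows "unit_vec vs \<in> free.span (tensor_relations scale n \<union> tuples C n)"
proof -
  let ?S = "free.span (tensor_relations scale n \<union> tuples C n)"
  have R: "f \<in> ?S" if "f \<in> multilinear_relators scale n" for f
    using relators_in_tensor_relations[OF that] by (auto intro: free.span_base)
  have "unit_vec (us @ ws) \<in> ?S"
    if "set us \<subseteq> C" "set ws \<subseteq> span C" "length us + length ws = n" for us ws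
    using that
  proof (induction ws arbitrary: us)
    case Nil
    then show ?case
      by (auto intro: free.span_base)
  next
    case (Cons a ws)
    have smult: "unit_vec (us @ scale c x # ws) \<in> ?S" if "unit_vec (us @ x # ws) \<in> ?S" for c x
    proof -
      have "unit_vec (us @ scale c x # ws) - free_scale c (unit_vec (us @ x # ws)) \<in> ?S"
        using Cons.prems(3) by (intro R relatorI) simp
      from free.span_add[OF this free.span_scale[OF that, of c]] show ?thesis
        by simp
    qed
    have add: "unit_vec (us @ (x + y) # ws) \<in> ?S"
      if "unit_vec (us @ x # ws) \<in> ?S" "unit_vec (us @ y # ws) \<in> ?S" for x y
    proof -
      have "unit_vec (us @ (x + y) # ws) - unit_vec (us @ x # ws) - unit_vec (us @ y # ws) \<in> ?S"
        using Cons.prems(3) by (intro R relatorI) simp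
      from free.span_add[OF free.span_add[OF this that(2)] that(1)] show ?thesis
        by simp
    qed
    have base: "unit_vec (us @ b # ws) \<in> ?S" if "b \<in> C" for b
      using Cons.IH[of "us @ [b]"] Cons.prems that by simp
    have "a \<in> span C"
      using Cons.prems(2) by simp
    then show ?case
    proof (induction rule: span_induct_alt)
      case base
      have "unit_vec (us @ scale 0 0 # ws) - free_scale 0 (unit_vec (us @ 0 # ws)) \<in> ?S"
        using Cons.prems(3) by (intro R relatorI) simp
      then show ?case by simp
    next
      case (step c x y)
      then show ?case
        using smult add base by blast
    qed
  qed
  from this[of "[]" vs] show ?thesis
    using assms by simp
qed

lemma diagonal_action_image:
  assumes "range (\<rho> g) \<subseteq> span C" "f \<in> free_tuples n"
  shows "diagonal_action \<rho> g f \<in> free.span (tensor_relations scale n \<union> tuples C n)"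
  using assms(2) unfolding free_tuples_eq_span diagonal_action_eq_lin_ext
proof (rule lin_ext_span)
  fix x :: "'v list \<Rightarrow>\<^sub>0 'k" assume "x \<in> unit_vec ` {vs. length vs = n}"
  then obtain vs where "x = unit_vec vs" "length vs = n" by blast
  then show "lin_ext (\<lambda>vs. unit_vec (map (\<rho> g) vs)) x
      \<in> free.span (tensor_relations scale n \<union> tuples C n)"
    using tensor_expansion[of "map (\<rho> g) vs" C n] assms(1) by (auto simp: image_subset_iff)
qed

text \<open>
  For lists of equal length this is the coefficient of the basis tensor \<open>b\<^sub>1 \<otimes> \<dots> \<otimes> b\<^sub>n\<close> in
  \<open>v\<^sub>1 \<otimes> \<dots> \<otimes> v\<^sub>n\<close>; the other cases only make the function total.
\<close>

fun tensor_coord :: "'v set \<Rightarrow> 'v list \<Rightarrow> 'v list \<Rightarrow> 'k" where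
  "tensor_coord B [] [] = 1"
| "tensor_coord B (v # vs) (b # bs) = representation B v b * tensor_coord B vs bs"
| "tensor_coord B _ _ = 0"

context
  fixes B :: "'v set"
  assumes indep: "independent B" and spanning: "span B = UNIV"
begin

lemma tensor_coord_multilinear:
  "tensor_coord B (us @ (x + y) # ws) bs = tensor_coord B (us @ x # ws) bs + tensor_coord B (us @ y # ws) bs"
  "tensor_coord B (us @ scale c x # ws) bs = c * tensor_coord B (us @ x # ws) bs"
proof -
  have rep: "representation B (x + y) b = representation B x b + representation B y b"
    "representation B (scale c x) b = c * representation B x b" for x y c b
    using representation_add[OF indep] representation_scale[OF indep] spanning by auto
  show "tensor_coord B (us @ (x + y) # ws) bs = tensor_coord B (us @ x # ws) bs + tensor_coord B (us @ y # ws) bs"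
  proof (induction us arbitrary: bs)
    case Nil
    then show ?case by (cases bs) (auto simp: rep algebra_simps)
  next
    case (Cons u us)
    then show ?case by (cases bs) (auto simp: algebra_simps)
  qed
  show "tensor_coord B (us @ scale c x # ws) bs = c * tensor_coord B (us @ x # ws) bs"
  proof (induction us arbitrary: bs)
    case Nil
    then show ?case by (cases bs) (auto simp: rep algebra_simps)
  next
    case (Cons u us)
    then show ?case by (cases bs) (auto simp: algebra_simps)
  qed
qed

lemma tensor_coord_basis:
  "set vs \<subseteq> B \<Longrightarrow> length vs = length bs \<Longrightarrow> tensor_coord B vs bs = (if vs = bs then 1 else 0)"
proof (induction vs arbitrary: bs)
  case Nil
  then show ?case by simp
next
  case (Cons v vs)
  then show ?case
    by (cases bs) (auto simp: representation_basis[OF indep])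
qed

text \<open>
  Reading off coordinates is a linear map that kills the relations and fixes the basis tensors, so
  the latter stay independent modulo the relations.
\<close>

lemma codim_tensor_relations:
  assumes fin: "finite B"
  shows "free.finite_codim (free_tuples n) (tensor_relations scale n)"
    and "free.codim (free_tuples n) (tensor_relations scale n) = card B ^ n"
proof -
  let ?R = "tensor_relations scale n" and ?F = "free_tuples n :: ('v list \<Rightarrow>\<^sub>0 'k) set"
  have F: "?F \<subseteq> free.span (?R \<union> tuples B n)"
    unfolding free_tuples_eq_span
  proof (rule free.span_minimal[OF _ free.subspace_span])
    show "unit_vec ` {vs. length vs = n} \<subseteq> free.span (?R \<union> tuples B n)"
      using tensor_expansion[of _ B n] spanning by auto
  qed
  note card = card_tuples[OF fin, of n]
  show fc: "free.finite_codim ?F ?R"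
    unfolding free.finite_codim_def using F card(1) by blast
  show "free.codim ?F ?R = card B ^ n"
  proof (rule antisym)
    show "free.codim ?F ?R \<le> card B ^ n"
      using free.codim_le[OF card(1) F] card(2) by simp
  next
    define L where "L = {bs. set bs \<subseteq> B \<and> length bs = n}"
    have "finite L"
      unfolding L_def using finite_lists_length_eq[OF fin] .
    define \<Psi> :: "('v list \<Rightarrow>\<^sub>0 'k) \<Rightarrow> ('v list \<Rightarrow>\<^sub>0 'k)"
      where "\<Psi> = lin_ext (\<lambda>vs. \<Sum>bs\<in>L. Poly_Mapping.single bs (tensor_coord B vs bs))"
    have scale_sum: "free_scale c (\<Sum>bs\<in>L. Poly_Mapping.single bs (h bs)) =
        (\<Sum>bs\<in>L. Poly_Mapping.single bs (c * h bs))" for c and h :: "'v list \<Rightarrow> 'k"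
      unfolding free.scale_sum_right
      by (rule sum.cong) (auto intro!: poly_mapping_eqI simp: lookup_single when_def)
    have \<Psi>_basis: "\<Psi> (unit_vec vs) = unit_vec vs" if "vs \<in> L" for vs
    proof -
      have "\<Psi> (unit_vec vs) = (\<Sum>bs\<in>L. if vs = bs then unit_vec bs else 0)"
        unfolding \<Psi>_def lin_ext_unit_vec
        by (rule sum.cong) (use that in \<open>auto simp: L_def tensor_coord_basis\<close>)
      also have "\<dots> = unit_vec vs"
        using that \<open>finite L\<close> by (simp add: sum.delta)
      finally show ?thesis .
    qed
    have \<Psi>_R: "\<Psi> f = 0" if "f \<in> ?R" for f
      using that unfolding tensor_relations_def
    proof (induction rule: free.span_induct_alt)
      case base
      show ?case by (simp add: \<Psi>_def lin_ext_simps)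
    next
      case (step c x y)
      have "\<Psi> x = 0"
        using step(1) unfolding multilinear_relators_def
      proof (elim UnE)
        assume "x \<in> {unit_vec (us @ (a + b) # ws) - unit_vec (us @ a # ws) - unit_vec (us @ b # ws)
          |us a b ws. length us + 1 + length ws = n}"
        then show ?thesis
          by (auto simp: \<Psi>_def lin_ext_simps tensor_coord_multilinear single_add sum.distrib)
      next
        assume "x \<in> {unit_vec (us @ scale c a # ws) - free_scale c (unit_vec (us @ a # ws))
          |us c a ws. length us + 1 + length ws = n}"
        then show ?thesis
          by (auto simp: \<Psi>_def lin_ext_simps tensor_coord_multilinear scale_sum)
      qed
      with step show ?case
        by (simp add: \<Psi>_def lin_ext_simps)
    qed
    obtain T where T: "finite T" "card T = free.codim ?F ?R" "?F \<subseteq> free.span (?R \<union> T)"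
      using free.codim_witness[OF fc] .
    have "tuples B n \<subseteq> free.span (\<Psi> ` T)"
    proof
      fix f assume "f \<in> tuples B n"
      then obtain vs where vs: "f = unit_vec vs" "vs \<in> L"
        unfolding L_def by blast
      have "f \<in> free.span (?R \<union> T)"
        using T(3) vs by (auto simp: free_tuples_def L_def)
      then have "\<Psi> f \<in> free.span (\<Psi> ` T)"
        unfolding \<Psi>_def
      proof (rule lin_ext_span, fold \<Psi>_def)
        show "\<Psi> x \<in> free.span (\<Psi> ` T)" if "x \<in> ?R \<union> T" for x
          using that \<Psi>_R free.span_zero by (auto intro: free.span_base)
      qed
      then show "f \<in> free.span (\<Psi> ` T)"
        using \<Psi>_basis vs by simp
    qed
    then have "card (tuples B n) \<le> card (\<Psi> ` T)"
      using free.independent_span_bound[OF finite_imageI[OF T(1)] independent_unit_vecs] by blast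
    also have "\<dots> \<le> card T"
      by (rule card_image_le[OF T(1)])
    finally show "card B ^ n \<le> free.codim ?F ?R"
      using T(2) card(2) by simp
  qed
qed

end

end


section \<open>Asymptotics of the length of tensor powers\<close>

lemma (in finite_dimensional_vector_space) ex_smaller_spanning_set_of_range:
  assumes "Vector_Spaces.linear scale scale f" "\<not> bij f"
  shows "\<exists>C. finite C \<and> card C < card Basis \<and> range f \<subseteq> span C"
proof -
  interpret f: Vector_Spaces.linear scale scale f by fact
  have "\<not> surj f"
    using assms linear_surj_imp_inj unfolding bij_def by blast
  then have "range f \<subset> UNIV" by blast
  moreover have "span (range f) = range f"
    by (rule span_eq_iff[THEN iffD2], rule f.subspace_image[OF subspace_UNIV])
  ultimately have "dim (range f) < dim (UNIV :: 'b set)"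
    by (intro dim_psubset) (simp only: span_UNIV)
  moreover obtain C where C: "independent C" "range f \<subseteq> span C" "card C = dim (range f)"
    using basis_exists[of "range f"] by blast
  ultimately show ?thesis
    using finiteI_independent by (intro exI[of _ C]) (simp add: dim_UNIV)
qed

text \<open>
  Let \<open>W\<close> be the sum of the images of the members of \<open>X\<close> on \<open>V\<^sup>\<otimes>\<^sup>n\<close>. Each image is the \<open>n\<close>-th tensor
  power of a proper subspace of \<open>V\<close>, so \<open>W\<close> has dimension at most \<open>card X * (dim V - 1)\<^sup>n\<close>. Everything
  outside \<open>U\<close> maps into \<open>W\<close>, and the exchange condition makes \<open>W\<close> invariant under \<open>U\<close>. Hence \<open>W\<close> is a
  submodule, and modulo \<open>W\<close> all operators commute. The factorisations are required of the
  operators only, so that they can be found by composing operators instead of multiplying diagrams.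
\<close>

lemma tensor_power_length_bounds:
  fixes scale :: "'k::alg_closed_field \<Rightarrow> 'v::ab_group_add \<Rightarrow> 'v"
    and M :: "('a, 'b) monoid_scheme" and \<rho> :: "'a \<Rightarrow> 'v \<Rightarrow> 'v"
  assumes mod: "fin_dim_monoid_module scale M \<rho>"
    and X: "finite X" "X \<subseteq> carrier M" "\<And>x. x \<in> X \<Longrightarrow> \<not> bij (\<rho> x)"
    and factor: "\<And>g. g \<in> carrier M \<Longrightarrow> g \<in> U \<or> (\<exists>x\<in>X. \<exists>y\<in>carrier M. \<rho> g = \<rho> x \<circ> \<rho> y)"
    and commute: "\<And>g h. g \<in> U \<Longrightarrow> h \<in> U \<Longrightarrow> \<rho> g \<circ> \<rho> h = \<rho> h \<circ> \<rho> g"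
    and exchange: "\<And>g x. g \<in> U \<Longrightarrow> x \<in> X \<Longrightarrow> \<exists>x'\<in>X. \<exists>y\<in>carrier M. \<rho> g \<circ> \<rho> x = \<rho> x' \<circ> \<rho> y"
  shows "tensor_power_length scale M \<rho> n \<le> vector_space.dim scale (UNIV :: 'v set) ^ n"
    and "vector_space.dim scale (UNIV :: 'v set) ^ n \<le>
      card X * (vector_space.dim scale (UNIV :: 'v set) - 1) ^ n + tensor_power_length scale M \<rho> n"
proof -
  interpret V: fin_dim_monoid_module scale M \<rho> by (fact mod)
  interpret V: tensor_powers scale by unfold_locales
  obtain B where B: "V.independent B" "UNIV \<subseteq> V.span B"
    using V.maximal_independent_subset[of UNIV] by blast
  obtain S0 where "finite S0" "V.span S0 = UNIV"
    using V.fin_dim by blast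
  then have fin: "finite B"
    using V.independent_span_bound[of S0 B] B(1) by simp
  have span_B: "V.span B = UNIV"
    using B(2) by blast
  interpret V: finite_dimensional_vector_space scale B
    by unfold_locales (use B(1) fin span_B in auto)
  define d where "d = vector_space.dim scale (UNIV :: 'v set)"
  have d: "d = card B"
    unfolding d_def by (rule V.dim_UNIV)
  let ?F = "free_tuples n :: ('v list \<Rightarrow>\<^sub>0 'k) set" and ?R = "tensor_relations scale n"
    and ?act = "diagonal_action \<rho> :: 'a \<Rightarrow> ('v list \<Rightarrow>\<^sub>0 'k) \<Rightarrow> ('v list \<Rightarrow>\<^sub>0 'k)"
  note codim_R = V.codim_tensor_relations[OF B(1) span_B fin, of n]
  interpret T: alg_closed_operator_module free_scale "carrier M" ?act ?F ?R
  proof (intro alg_closed_operator_module.intro operator_module.intro operator_module_axioms.intro)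
    fix g assume "g \<in> carrier M"
    then show "?act g ` ?R \<subseteq> ?R"
      by (intro V.diagonal_action_tensor_relations V.action_linear)
  qed (rule free.ambient_space_axioms diagonal_action_linear subspace_free_tuples codim_R(1)
      V.subspace_tensor_relations V.tensor_relations_le diagonal_action_free_tuples)+
  have length_eq: "tensor_power_length scale M \<rho> n = composition_length free_scale (carrier M) ?act ?F ?R"
    by (simp add: tensor_power_length_def)
  have "tensor_power_length scale M \<rho> n \<le> d ^ n"
    unfolding length_eq d using T.composition_length_le_codim codim_R(2) by simp
  then show "tensor_power_length scale M \<rho> n \<le> vector_space.dim scale (UNIV :: 'v set) ^ n"
    unfolding d_def .
  have act_F: "?act g f \<in> ?F" if "f \<in> ?F" for g f
    using diagonal_action_free_tuples that by (rule subsetD[OF _ imageI])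
  have "\<forall>x\<in>X. \<exists>C. finite C \<and> card C < d \<and> range (\<rho> x) \<subseteq> V.span C"
    unfolding d using V.ex_smaller_spanning_set_of_range V.action_linear X(2,3) by blast
  then obtain C where C: "\<And>x. x \<in> X \<Longrightarrow> finite (C x)" "\<And>x. x \<in> X \<Longrightarrow> card (C x) < d"
    "\<And>x. x \<in> X \<Longrightarrow> range (\<rho> x) \<subseteq> V.span (C x)"
    by (auto dest!: bchoice)
  define T where "T = (\<Union>x\<in>X. V.tuples (C x) n)"
  define W where "W = free.span (?R \<union> (\<Union>x\<in>X. ?act x ` ?F))"
  have W_base: "?act x f \<in> W" if "x \<in> X" "f \<in> ?F" for x f
    unfolding W_def using that by (intro free.span_base) blast
  have R_W: "?R \<subseteq> W"
    unfolding W_def using free.span_superset[of "?R \<union> (\<Union>x\<in>X. ?act x ` ?F)"] by simp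
  have outside_U: "?act g f \<in> W" if g: "g \<in> carrier M" "g \<notin> U" and f: "f \<in> ?F" for g f
  proof -
    obtain x y where "x \<in> X" "\<rho> g = \<rho> x \<circ> \<rho> y"
      using factor[OF g(1)] g(2) by blast
    then show ?thesis
      using diagonal_action_factor[of \<rho> g x y f n] f W_base by auto
  qed
  have W: "T.submodule W"
    unfolding quotient_submodule_def
  proof (intro conjI ballI)
    show "free.subspace W"
      unfolding W_def by (rule free.subspace_span)
    show "?R \<subseteq> W"
      by (fact R_W)
    show "W \<subseteq> ?F"
      unfolding W_def
      by (rule free.span_minimal[OF _ subspace_free_tuples]) (use V.tensor_relations_le act_F in auto)
  next
    fix g assume g: "g \<in> carrier M"
    have "?act g f \<in> W" if f: "f \<in> ?R \<union> (\<Union>x\<in>X. ?act x ` ?F)" for f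
    proof (cases "g \<in> U \<and> f \<notin> ?R")
      case True
      then obtain x f' where f': "x \<in> X" "f' \<in> ?F" "f = ?act x f'"
        using f by auto
      obtain x' y where "x' \<in> X" "\<rho> g \<circ> \<rho> x = \<rho> x' \<circ> \<rho> y"
        using exchange f'(1) True by blast
      then show ?thesis
        unfolding f'(3) using diagonal_action_comp[of \<rho> g x x' y f'] W_base act_F f'(2) by simp
    next
      case False
      have "f \<in> ?F"
        using f V.tensor_relations_le act_F by auto
      then show ?thesis
        using False outside_U g T.act_R[OF g] R_W by blast
    qed
    then have "?act g ` (?R \<union> (\<Union>x\<in>X. ?act x ` ?F)) \<subseteq> W"
      by (rule image_subsetI)
    then have "free.span (?act g ` (?R \<union> (\<Union>x\<in>X. ?act x ` ?F))) \<subseteq> W"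
      by (rule free.span_minimal) (simp add: W_def)
    moreover have "free.span (?act g ` (?R \<union> (\<Union>x\<in>X. ?act x ` ?F))) = ?act g ` W"
      unfolding W_def
      by (rule module_hom.span_image) (rule diagonal_action_linear[unfolded linear_iff_module_hom])
    ultimately show "?act g ` W \<subseteq> W"
      by simp
  qed
  have comm: "?act g (?act h f) - ?act h (?act g f) \<in> W"
    if "g \<in> carrier M" "h \<in> carrier M" "f \<in> ?F" for g h f
  proof (cases "g \<in> U \<and> h \<in> U")
    case True
    then have "?act g (?act h f) = ?act h (?act g f)"
      using commute by (intro diagonal_action_comp) simp
    then show ?thesis
      using free.subspace_0[OF T.submoduleD(1)[OF W]] by simp
  next
    case False
    then have "?act g (?act h f) \<in> W" "?act h (?act g f) \<in> W"
      using outside_U that act_F T.submoduleD(4)[OF W] by metis+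
    then show ?thesis
      using free.subspace_diff[OF T.submoduleD(1)[OF W]] by blast
  qed
  have fin_T: "finite T"
    unfolding T_def using X(1) C(1) V.card_tuples(1) by blast
  have "card T \<le> (\<Sum>x\<in>X. card (V.tuples (C x) n))"
    unfolding T_def by (rule card_UN_le[OF X(1)])
  also have "\<dots> \<le> (\<Sum>x\<in>X. (d - 1) ^ n)"
  proof (rule sum_mono)
    fix x assume "x \<in> X"
    then have "card (C x) \<le> d - 1"
      using C(2) by fastforce
    then show "card (V.tuples (C x) n) \<le> (d - 1) ^ n"
      using V.card_tuples(2)[OF C(1)[OF \<open>x \<in> X\<close>]] by (simp add: power_mono)
  qed
  finally have card_T: "card T \<le> card X * (d - 1) ^ n"
    by simp
  have "W \<subseteq> free.span (?R \<union> T)"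
    unfolding W_def
  proof (rule free.span_minimal[OF _ free.subspace_span], rule Un_least)
    show "?R \<subseteq> free.span (?R \<union> T)"
      using free.span_superset[of "?R \<union> T"] by simp
    show "(\<Union>x\<in>X. ?act x ` ?F) \<subseteq> free.span (?R \<union> T)"
    proof clarify
      fix x f assume x: "x \<in> X" and f: "f \<in> ?F"
      have "?R \<union> V.tuples (C x) n \<subseteq> ?R \<union> T"
        unfolding T_def using x by blast
      then have "free.span (?R \<union> V.tuples (C x) n) \<subseteq> free.span (?R \<union> T)"
        by (rule free.span_mono)
      moreover have "?act x f \<in> free.span (?R \<union> V.tuples (C x) n)"
        using C(3)[OF x] f by (rule V.diagonal_action_image)
      ultimately show "?act x f \<in> free.span (?R \<union> T)"
        by (rule subsetD)
    qed
  qed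
  then have "free.codim ?F ?R \<le> free.codim ?F W + card T"
    by (rule free.codim_le_add[OF T.finite_codim_submodule[OF W] fin_T])
  also have "free.codim ?F W \<le> tensor_power_length scale M \<rho> n"
    unfolding length_eq by (rule T.codim_le_composition_length[OF W comm])
  finally have "d ^ n \<le> card X * (d - 1) ^ n + tensor_power_length scale M \<rho> n"
    using card_T codim_R(2) d by simp
  then show "vector_space.dim scale (UNIV :: 'v set) ^ n \<le>
      card X * (vector_space.dim scale (UNIV :: 'v set) - 1) ^ n + tensor_power_length scale M \<rho> n"
    unfolding d_def .
qed

lemma asymp_equiv_powers:
  fixes l :: "nat \<Rightarrow> nat"
  assumes "\<And>n. l n \<le> d ^ n" "\<And>n. d ^ n \<le> r * (d - 1) ^ n + l n"
  shows "(\<lambda>n. real (l n)) \<sim>[sequentially] (\<lambda>n. real d ^ n)"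
proof (cases "d = 0")
  case True
  \<comment> \<open>Both sides vanish for \<open>n > 0\<close>; at \<open>n = 0\<close> the right-hand side is \<open>0\<^sup>0 = 1\<close>.\<close>
  have "eventually (\<lambda>n. real (l n) = real d ^ n) sequentially"
    using eventually_gt_at_top[of 0]
  proof eventually_elim
    case (elim n)
    then show ?case
      using assms(1)[of n] True by (simp add: zero_power)
  qed
  then show ?thesis
    by (rule asymp_equiv_refl_ev)
next
  case False
  define c where "c = real (d - 1)"
  have "(\<lambda>n. real (l n) / real d ^ n) \<longlonglongrightarrow> 1"
  proof (rule tendsto_sandwich)
    show "eventually (\<lambda>n. 1 - real r * (c / real d) ^ n \<le> real (l n) / real d ^ n) sequentially"
    proof (rule always_eventually, rule allI)
      fix n
      have "real (d ^ n) \<le> real (r * (d - 1) ^ n + l n)"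
        using assms(2) of_nat_le_iff by blast
      then have "real d ^ n - real r * c ^ n \<le> real (l n)"
        unfolding c_def by simp
      then have "(real d ^ n - real r * c ^ n) / real d ^ n \<le> real (l n) / real d ^ n"
        by (rule divide_right_mono) simp
      then show "1 - real r * (c / real d) ^ n \<le> real (l n) / real d ^ n"
        using False by (simp add: diff_divide_distrib power_divide)
    qed
    show "eventually (\<lambda>n. real (l n) / real d ^ n \<le> 1) sequentially"
    proof (rule always_eventually, rule allI)
      fix n
      have "real (l n) \<le> real (d ^ n)"
        using assms(1) of_nat_le_iff by blast
      then show "real (l n) / real d ^ n \<le> 1"
        using False by simp
    qed
    have "0 \<le> c" "c < real d"
      unfolding c_def using False by auto
    then have "norm (c / real d) < 1"
      by simp
    then have "(\<lambda>n. (c / real d) ^ n) \<longlonglongrightarrow> 0"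
      by (rule LIMSEQ_power_zero)
    then have "(\<lambda>n. 1 - real r * (c / real d) ^ n) \<longlonglongrightarrow> 1 - real r * 0"
      by (intro tendsto_diff tendsto_mult tendsto_const)
    then show "(\<lambda>n. 1 - real r * (c / real d) ^ n) \<longlonglongrightarrow> 1"
      by simp
  qed simp
  then show ?thesis
    by (intro asymp_equivI') simp
qed


section \<open>Components of a stack of two diagrams\<close>

abbreviation strip :: "vertex set" where
  "strip \<equiv> UNIV \<times> {0, 1}"

abbreviation tall_strip :: "vertex set" where
  "tall_strip \<equiv> UNIV \<times> {0, 1, 2}"

definition lift :: "vertex \<Rightarrow> vertex" where
  "lift = (\<lambda>(x, h). (x, Suc h))"

definition stack_edges :: "vertex set set \<Rightarrow> vertex set set \<Rightarrow> (vertex \<times> vertex) set" where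
  "stack_edges P Q = (\<Union>B \<in> (`) lift ` P \<union> Q. B \<times> B)"

lemma stack_components_eq: "stack_components P Q = tall_strip // (stack_edges P Q)\<^sup>*"
  by (simp add: stack_components_def stack_edges_def lift_def)

lemma stack_edgesI:
  "B \<in> P \<Longrightarrow> u \<in> B \<Longrightarrow> v \<in> B \<Longrightarrow> (lift u, lift v) \<in> (stack_edges P Q)\<^sup>*"
  "B \<in> Q \<Longrightarrow> u \<in> B \<Longrightarrow> v \<in> B \<Longrightarrow> (u, v) \<in> (stack_edges P Q)\<^sup>*"
  unfolding stack_edges_def by (rule r_into_rtrancl, blast)+

lemma lift_image_strip: "lift ` strip \<subseteq> tall_strip"
  by (auto simp: lift_def)

lemma partition_on_same_block:
  "partition_on A P \<Longrightarrow> B \<in> P \<Longrightarrow> C \<in> P \<Longrightarrow> v \<in> B \<Longrightarrow> v \<in> C \<Longrightarrow> B = C"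
  unfolding partition_on_def disjoint_def by blast

lemma stack_edges_in_tall_strip:
  assumes "\<Union>P \<subseteq> strip" "\<Union>Q \<subseteq> strip" "(u, v) \<in> (stack_edges P Q)\<^sup>*" "u \<in> tall_strip"
  shows "v \<in> tall_strip"
  using assms(3,4)
proof (induction rule: rtrancl_induct)
  case (step v w)
  then obtain B where B: "B \<in> (`) lift ` P \<union> Q" "w \<in> B"
    unfolding stack_edges_def by blast
  from B(1) show ?case
  proof
    assume "B \<in> (`) lift ` P"
    then have "B \<subseteq> lift ` strip"
      using assms(1) by blast
    then show ?thesis
      using B(2) lift_image_strip by blast
  next
    assume "B \<in> Q"
    then have "B \<subseteq> strip"
      using assms(2) by blast
    then show ?thesis
      using B(2) by auto
  qed
qed

text \<open>
  The map \<open>f\<close> moves every vertex along a path in the stack, so every component meets the image of \<open>f\<close>,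
  and no edge leads from the preimage of one member of \<open>\<D>\<close> to that of another. This retraction is
  how all products below are computed.
\<close>

lemma stack_components_retract:
  assumes P: "\<Union>P \<subseteq> strip" and Q: "\<Union>Q \<subseteq> strip"
    and f: "f ` tall_strip \<subseteq> tall_strip" and D: "partition_on (f ` tall_strip) \<D>"
    and clique: "\<And>D. D \<in> \<D> \<Longrightarrow> D \<times> D \<subseteq> (stack_edges P Q)\<^sup>*"
    and conn: "\<And>v. v \<in> tall_strip \<Longrightarrow> (v, f v) \<in> (stack_edges P Q)\<^sup>*"
    and upper: "\<And>B. B \<in> P \<Longrightarrow> \<exists>D\<in>\<D>. f ` lift ` B \<subseteq> D"
    and lower: "\<And>B. B \<in> Q \<Longrightarrow> \<exists>D\<in>\<D>. f ` B \<subseteq> D"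
  shows "stack_components P Q = (\<lambda>D. tall_strip \<inter> f -` D) ` \<D>"
proof -
  let ?E = "stack_edges P Q"
  have "sym ?E"
    unfolding stack_edges_def by (rule symI) blast
  then have sym: "(v, u) \<in> ?E\<^sup>*" if "(u, v) \<in> ?E\<^sup>*" for u v
    using sym_rtrancl that by (blast dest: symD)
  have same: "f v \<in> D" if "(u, v) \<in> ?E\<^sup>*" "D \<in> \<D>" "f u \<in> D" for u v D
    using that
  proof (induction rule: rtrancl_induct)
    case (step v w)
    then obtain B where B: "B \<in> (`) lift ` P \<union> Q" "v \<in> B" "w \<in> B"
      unfolding stack_edges_def by blast
    have "\<exists>D\<in>\<D>. f ` B \<subseteq> D"
      using B(1) upper lower by auto
    then obtain D' where "D' \<in> \<D>" "f v \<in> D'" "f w \<in> D'"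
      using B by blast
    then show ?case
      using partition_on_same_block[OF D] step by metis
  qed
  have cls: "?E\<^sup>* `` {v} = tall_strip \<inter> f -` D" if v: "v \<in> tall_strip" "D \<in> \<D>" "f v \<in> D" for v D
  proof
    show "?E\<^sup>* `` {v} \<subseteq> tall_strip \<inter> f -` D"
    proof
      fix u assume "u \<in> ?E\<^sup>* `` {v}"
      then have vu: "(v, u) \<in> ?E\<^sup>*" by simp
      then have "u \<in> tall_strip" "f u \<in> D"
        using stack_edges_in_tall_strip[OF P Q vu v(1)] same[OF vu v(2,3)] by simp_all
      then show "u \<in> tall_strip \<inter> f -` D" by simp
    qed
    show "tall_strip \<inter> f -` D \<subseteq> ?E\<^sup>* `` {v}"
    proof
      fix u assume "u \<in> tall_strip \<inter> f -` D"
      then have u: "u \<in> tall_strip" "f u \<in> D" by simp_all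
      have "(v, f v) \<in> ?E\<^sup>*"
        using v(1) by (rule conn)
      also have "(f v, f u) \<in> ?E\<^sup>*"
        using clique[OF v(2)] v(3) u(2) by (rule subsetD[OF _ SigmaI])
      also have "(f u, u) \<in> ?E\<^sup>*"
        using conn[OF u(1)] by (rule sym)
      finally show "u \<in> ?E\<^sup>* `` {v}"
        by simp
    qed
  qed
  show ?thesis
  proof (intro subset_antisym subsetI)
    fix C assume "C \<in> stack_components P Q"
    then obtain v where v: "v \<in> tall_strip" "C = ?E\<^sup>* `` {v}"
      unfolding stack_components_eq by (elim quotientE)
    then have "f v \<in> \<Union>\<D>"
      using partition_onD1[OF D] by blast
    then obtain D where "D \<in> \<D>" "f v \<in> D" by blast
    then show "C \<in> (\<lambda>D. tall_strip \<inter> f -` D) ` \<D>"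
      using cls v by blast
  next
    fix C assume "C \<in> (\<lambda>D. tall_strip \<inter> f -` D) ` \<D>"
    then obtain D where D': "D \<in> \<D>" "C = tall_strip \<inter> f -` D" by blast
    then have "D \<noteq> {}" "D \<subseteq> f ` tall_strip"
      using D unfolding partition_on_def by auto
    then obtain v where "v \<in> tall_strip" "f v \<in> D" by blast
    then show "C \<in> stack_components P Q"
      unfolding stack_components_eq using cls D' by (metis quotientI)
  qed
qed

text \<open>
  The component of the product that a component of the stack leaves behind; the outer rows of the
  stack have heights 0 and 2.
\<close>

definition squash :: "vertex set \<Rightarrow> vertex set" where
  "squash C = (\<lambda>(x, h). (x, h div 2)) ` (C - middle)"

lemma stack_partition_eq: "stack_partition P Q = squash ` {C \<in> stack_components P Q. \<not> C \<subseteq> middle}"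
  unfolding stack_partition_def squash_def by blast

lemma mem_squash:
  assumes "C \<subseteq> tall_strip"
  shows "v \<in> squash C \<longleftrightarrow> (snd v = 0 \<and> (fst v, 0) \<in> C) \<or> (snd v = 1 \<and> (fst v, 2) \<in> C)"
proof -
  have "v \<in> squash C \<longleftrightarrow> (\<exists>k. (fst v, k) \<in> C \<and> k \<noteq> 1 \<and> snd v = k div 2)"
    by (cases v) (auto simp: squash_def middle_def image_iff Bex_def)
  also have "\<dots> \<longleftrightarrow> (\<exists>k\<in>{0, 2}. (fst v, k) \<in> C \<and> snd v = k div 2)"
    using assms by fastforce
  finally show ?thesis by auto
qed

lemma stack_partition_strip:
  assumes "\<Union>P \<subseteq> strip" "\<Union>Q \<subseteq> strip"
  shows "\<Union>(stack_partition P Q) \<subseteq> strip"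
proof -
  have "C \<subseteq> tall_strip" if "C \<in> stack_components P Q" for C
    using that stack_edges_in_tall_strip[OF assms] unfolding stack_components_eq by (auto elim!: quotientE)
  then show ?thesis
    unfolding stack_partition_eq using mem_squash by fastforce
qed


text \<open>No edge of the stack leaves a component that lies in the top row.\<close>

lemma top_block_persists:
  assumes P: "partition_on strip P" and Q: "\<Union>Q \<subseteq> strip" and B: "B \<in> P" "B \<subseteq> UNIV \<times> {1}"
  shows "\<exists>I\<in>stack_partition P Q. I \<subseteq> UNIV \<times> {1}"
proof -
  have "B \<noteq> {}"
    using P B(1) unfolding partition_on_def by blast
  then obtain x where x: "(x, 1) \<in> B"
    using B(2) by blast
  let ?C = "(stack_edges P Q)\<^sup>* `` {(x, 2)}"
  have "v \<in> lift ` B" if "((x, 2), v) \<in> (stack_edges P Q)\<^sup>*" for v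
    using that
  proof (induction rule: rtrancl_induct)
    case base
    show ?case
      using x by (force simp: lift_def)
  next
    case (step v w)
    then obtain D where D: "D \<in> (`) lift ` P \<union> Q" "v \<in> D" "w \<in> D"
      unfolding stack_edges_def by blast
    have "v \<notin> strip"
      using step.IH B(2) by (auto simp: lift_def)
    then have "D \<notin> Q"
      using D(2) Q by blast
    then obtain B' where B': "B' \<in> P" "D = lift ` B'"
      using D(1) by blast
    moreover have "inj lift"
      by (auto simp: lift_def inj_def)
    ultimately have "B' = B"
      using partition_on_same_block[OF P B'(1) B(1)] step.IH D(2) by (auto dest: injD)
    then show ?case
      using D(3) B'(2) by blast
  qed
  then have C: "?C \<subseteq> lift ` B"
    by blast
  have "?C \<in> stack_components P Q"
    unfolding stack_components_eq by (rule quotientI) simp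
  moreover have "(x, 2) \<in> ?C - middle"
    by (simp add: middle_def)
  ultimately have "squash ?C \<in> stack_partition P Q"
    unfolding stack_partition_eq by blast
  moreover have "squash ?C \<subseteq> UNIV \<times> {1}"
    using C B(2) unfolding squash_def lift_def by fastforce
  ultimately show ?thesis by blast
qed

lemma top_block_not_right_invertible:
  assumes "partition_on strip P" "\<Union>Q \<subseteq> strip" "B \<in> P" "B \<subseteq> UNIV \<times> {1}"
  shows "stack_partition P Q \<noteq> fst id_diagram"
  using top_block_persists[OF assms] unfolding id_diagram_def by fastforce


section \<open>Rotations and caps\<close>

definition rotation :: "int \<Rightarrow> vertex set set" where
  "rotation s = {{(x + s, 1), (x, 0)} | x. True}"

definition shift_rows :: "int \<Rightarrow> int \<Rightarrow> vertex \<Rightarrow> vertex" where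
  "shift_rows b t = (\<lambda>(x, h). (if h = 0 then x + b else x + t, h))"

lemma mem_shift_rows:
  assumes "B \<subseteq> strip"
  shows "v \<in> shift_rows b t ` B \<longleftrightarrow>
    (snd v = 0 \<and> (fst v - b, 0) \<in> B) \<or> (snd v = 1 \<and> (fst v - t, 1) \<in> B)"
proof
  assume "v \<in> shift_rows b t ` B"
  then obtain x h where "(x, h) \<in> B" "v = shift_rows b t (x, h)" by auto
  moreover from this have "h = 0 \<or> h = 1"
    using assms by blast
  ultimately show "(snd v = 0 \<and> (fst v - b, 0) \<in> B) \<or> (snd v = 1 \<and> (fst v - t, 1) \<in> B)"
    by (auto simp: shift_rows_def)
next
  assume "(snd v = 0 \<and> (fst v - b, 0) \<in> B) \<or> (snd v = 1 \<and> (fst v - t, 1) \<in> B)"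
  then show "v \<in> shift_rows b t ` B"
  proof (elim disjE conjE)
    assume "snd v = 0" "(fst v - b, 0) \<in> B"
    then show ?thesis
      by (cases v) (auto simp: shift_rows_def intro!: rev_image_eqI[of "(fst v - b, 0)"])
  next
    assume "snd v = 1" "(fst v - t, 1) \<in> B"
    then show ?thesis
      by (cases v) (auto simp: shift_rows_def intro!: rev_image_eqI[of "(fst v - t, 1)"])
  qed
qed

lemma rotation_strip: "\<Union>(rotation s) \<subseteq> strip"
  by (auto simp: rotation_def)

lemma new_loops_0:
  assumes "\<And>C. C \<in> stack_components P Q \<Longrightarrow> \<not> C \<subseteq> middle \<or> finite C"
  shows "new_loops P Q = 0"
proof -
  have "{C \<in> stack_components P Q. C \<subseteq> middle \<and> infinite C} = {}"
    using assms by blast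
  then show ?thesis
    by (simp only: new_loops_def card.empty)
qed

lemma not_subset_if_mem_Diff: "v \<in> A - B \<Longrightarrow> \<not> A \<subseteq> B"
  by blast

text \<open>
  In all the products below, the components \<open>\<M>\<close> that stay in the middle row are finite, so that no
  loops arise, and every other component is read off from a member of \<open>\<D>\<close>.
\<close>

lemma stack_by_components:
  assumes C: "stack_components P Q = c ` \<D> \<union> \<M>"
    and not_middle: "\<And>D. D \<in> \<D> \<Longrightarrow> \<not> c D \<subseteq> middle"
    and middle: "\<And>E. E \<in> \<M> \<Longrightarrow> E \<subseteq> middle \<and> finite E"
    and sq: "\<And>D. D \<in> \<D> \<Longrightarrow> squash (c D) = g D"
  shows "stack_partition P Q = g ` \<D>" "new_loops P Q = 0"
proof -
  have "{C \<in> stack_components P Q. \<not> C \<subseteq> middle} = c ` \<D>"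
    unfolding C using not_middle middle by auto
  then show "stack_partition P Q = g ` \<D>"
    unfolding stack_partition_eq using sq by (simp add: image_image cong: image_cong)
  show "new_loops P Q = 0"
    by (rule new_loops_0) (use C not_middle middle in auto)
qed

lemmas stack_no_middle = stack_by_components[where \<M> = "{}", unfolded Un_empty_right]

text \<open>
  The stack retracts along the lines of the rotation onto the other diagram. Every line ends in an
  outer row, so no component stays in the middle.
\<close>

lemma stack_rotation_left:
  assumes Q: "partition_on strip Q"
  shows "stack_partition (rotation s) Q = (`) (shift_rows 0 s) ` Q" "new_loops (rotation s) Q = 0"
proof -
  define f :: "vertex \<Rightarrow> vertex" where "f = (\<lambda>(x, h). if h = 2 then (x - s, 1) else (x, h))"
  have Q': "\<Union>Q \<subseteq> strip"
    using partition_onD1[OF Q] by simp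
  have f_image: "f ` tall_strip = strip"
    by (force simp: f_def image_iff)
  have C: "stack_components (rotation s) Q = (\<lambda>D. tall_strip \<inter> f -` D) ` Q"
  proof (rule stack_components_retract)
    show "partition_on (f ` tall_strip) Q"
      using Q f_image by simp
    show "f ` tall_strip \<subseteq> tall_strip"
      unfolding f_image by auto
    show "D \<times> D \<subseteq> (stack_edges (rotation s) Q)\<^sup>*" if "D \<in> Q" for D
      using that unfolding stack_edges_def by blast
    show "\<exists>D\<in>Q. f ` B \<subseteq> D" if "B \<in> Q" for B
    proof -
      have "f v = v" if "v \<in> B" for v
        using that \<open>B \<in> Q\<close> Q' by (fastforce simp: f_def)
      then show ?thesis
        using that by (intro bexI[of _ B]) auto
    qed
    show "\<exists>D\<in>Q. f ` lift ` B \<subseteq> D" if B: "B \<in> rotation s" for B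
    proof -
      obtain x where x: "B = {(x + s, 1), (x, 0)}"
        using B unfolding rotation_def by blast
      have "(x, 1) \<in> \<Union>Q"
        using partition_onD1[OF Q] by auto
      then show ?thesis
        unfolding x by (auto simp: lift_def f_def)
    qed
    show "(v, f v) \<in> (stack_edges (rotation s) Q)\<^sup>*" if v: "v \<in> tall_strip" for v
    proof (cases "snd v = 2")
      case True
      have "{(fst v, 1), (fst v - s, 0)} \<in> rotation s"
        unfolding rotation_def by (intro CollectI exI[of _ "fst v - s"]) simp
      then have "(lift (fst v, 1), lift (fst v - s, 0)) \<in> (stack_edges (rotation s) Q)\<^sup>*"
        by (rule stack_edgesI) simp_all
      then show ?thesis
        using True by (cases v) (simp add: lift_def f_def numeral_2_eq_2)
    next
      case False
      then have "f v = v"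
        by (cases v) (simp add: f_def)
      then show ?thesis by simp
    qed
  qed (fact rotation_strip Q')+
  have not_middle: "\<not> tall_strip \<inter> f -` D \<subseteq> middle" if D: "D \<in> Q" for D
  proof -
    have "D \<noteq> {}"
      using D partition_onD3[OF Q] by metis
    have "D \<subseteq> strip"
      using Union_upper[OF D] Q' by (rule order_trans)
    obtain x h where xh: "(x, h) \<in> D"
      using \<open>D \<noteq> {}\<close> by (metis ex_in_conv surj_pair)
    then have "h = 0 \<or> h = 1"
      using \<open>D \<subseteq> strip\<close> by blast
    with xh have "(if h = 0 then (x, 0) else (x + s, 2)) \<in> (tall_strip \<inter> f -` D) - middle"
      by (auto simp: f_def middle_def)
    then show ?thesis by (rule not_subset_if_mem_Diff)
  qed
  have sq: "squash (tall_strip \<inter> f -` D) = shift_rows 0 s ` D" if D: "D \<in> Q" for D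
  proof -
    have "D \<subseteq> strip"
      using Union_upper[OF D] Q' by (rule order_trans)
    then have "v \<in> squash (tall_strip \<inter> f -` D) \<longleftrightarrow> v \<in> shift_rows 0 s ` D" for v
      by (subst mem_squash, simp, subst mem_shift_rows, assumption) (simp add: f_def)
    then show ?thesis by (rule Set.set_eqI)
  qed
  show "stack_partition (rotation s) Q = (`) (shift_rows 0 s) ` Q" "new_loops (rotation s) Q = 0"
    by (rule stack_no_middle[OF C not_middle _ sq]; simp)+
qed

lemma stack_rotation_right:
  assumes P: "partition_on strip P"
  shows "stack_partition P (rotation s) = (`) (shift_rows (- s) 0) ` P" "new_loops P (rotation s) = 0"
proof -
  define f :: "vertex \<Rightarrow> vertex" where "f = (\<lambda>(x, h). if h = 0 then (x + s, 1) else (x, h))"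
  have P': "\<Union>P \<subseteq> strip"
    using partition_onD1[OF P] by simp
  have f_image: "f ` tall_strip = lift ` strip"
    by (force simp: f_def lift_def image_iff numeral_2_eq_2)
  have inj_lift: "inj lift"
    by (auto simp: lift_def inj_def)
  have f_lift: "f (lift v) = lift v" for v
    by (cases v) (simp add: f_def lift_def)
  have part: "partition_on (lift ` strip) ((`) lift ` P)"
  proof -
    have "{} \<notin> (`) lift ` P"
      using partition_onD3[OF P] by auto
    then have "(`) lift ` P - {{}} = (`) lift ` P"
      by simp
    with partition_on_inj_image[OF P inj_on_subset[OF inj_lift subset_UNIV]] show ?thesis
      by simp
  qed
  have C: "stack_components P (rotation s) = (\<lambda>D. tall_strip \<inter> f -` D) ` ((`) lift ` P)"
  proof (rule stack_components_retract)
    show "partition_on (f ` tall_strip) ((`) lift ` P)"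
      using part f_image by simp
    show "f ` tall_strip \<subseteq> tall_strip"
      unfolding f_image by (rule lift_image_strip)
    show "D \<times> D \<subseteq> (stack_edges P (rotation s))\<^sup>*" if "D \<in> (`) lift ` P" for D
      using that unfolding stack_edges_def by blast
    show "\<exists>D\<in>(`) lift ` P. f ` lift ` B \<subseteq> D" if "B \<in> P" for B
      using that by (intro bexI[of _ "lift ` B"]) (auto simp: f_lift)
    show "\<exists>D\<in>(`) lift ` P. f ` B \<subseteq> D" if B: "B \<in> rotation s" for B
    proof -
      obtain x where x: "B = {(x + s, 1), (x, 0)}"
        using B unfolding rotation_def by blast
      have "(x + s, 0) \<in> \<Union>P"
        using partition_onD1[OF P] by auto
      then obtain D where D: "D \<in> P" "(x + s, 0) \<in> D" by blast
      then have "(x + s, 1) \<in> lift ` D"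
        by (force simp: lift_def)
      then show ?thesis
        unfolding x using D(1) by (intro bexI[of _ "lift ` D"]) (auto simp: f_def)
    qed
    show "(v, f v) \<in> (stack_edges P (rotation s))\<^sup>*" if v: "v \<in> tall_strip" for v
    proof (cases "snd v = 0")
      case True
      then have "{f v, v} \<in> rotation s"
        unfolding rotation_def by (cases v) (auto simp: f_def)
      then show ?thesis
        by (rule stack_edgesI) simp_all
    next
      case False
      then have "f v = v"
        by (cases v) (simp add: f_def)
      then show ?thesis by simp
    qed
  qed (fact rotation_strip P')+
  have lift_iff: "(x, Suc h) \<in> lift ` B \<longleftrightarrow> (x, h) \<in> B" for x h B
    by (force simp: lift_def)
  have not_middle: "\<not> tall_strip \<inter> f -` lift ` B \<subseteq> middle" if B: "B \<in> P" for B
  proof -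
    have "B \<noteq> {}"
      using B partition_onD3[OF P] by metis
    have "B \<subseteq> strip"
      using Union_upper[OF B] P' by (rule order_trans)
    obtain x h where xh: "(x, h) \<in> B"
      using \<open>B \<noteq> {}\<close> by (metis ex_in_conv surj_pair)
    then have "h = 0 \<or> h = 1"
      using \<open>B \<subseteq> strip\<close> by blast
    with xh have "(if h = 0 then (x - s, 0) else (x, 2)) \<in> (tall_strip \<inter> f -` lift ` B) - middle"
      using lift_iff[of x h B] by (auto simp: f_def middle_def numeral_2_eq_2)
    then show ?thesis by (rule not_subset_if_mem_Diff)
  qed
  have sq: "squash (tall_strip \<inter> f -` lift ` B) = shift_rows (- s) 0 ` B" if B: "B \<in> P" for B
  proof -
    have BS: "B \<subseteq> strip"
      using Union_upper[OF B] P' by (rule order_trans)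
    have "v \<in> squash (tall_strip \<inter> f -` lift ` B) \<longleftrightarrow> v \<in> shift_rows (- s) 0 ` B" for v
      using lift_iff[of _ 0 B] lift_iff[of _ 1 B]
      by (simp add: mem_squash mem_shift_rows[OF BS] f_def numeral_2_eq_2)
    then show ?thesis by (rule Set.set_eqI)
  qed
  show "stack_partition P (rotation s) = (`) (shift_rows (- s) 0) ` P" "new_loops P (rotation s) = 0"
    by (rule stack_no_middle[OF C[unfolded image_image] not_middle _ sq]; simp)+
qed


text \<open>
  If \<open>K\<close> consists of the translates of \<open>{i, i + 1}\<close> by multiples of \<open>m \<ge> 2\<close>, this is the generator \<open>e\<^sub>i\<close>.
  If it consists of the translates of \<open>{i}\<close>, this is the idempotent that cuts the vertical lines at the
  positions congruent to \<open>i\<close>.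
\<close>

definition cap_blocks :: "int set set \<Rightarrow> vertex set set" where
  "cap_blocks K = (\<lambda>I. I \<times> {0}) ` K \<union> (\<lambda>I. I \<times> {1}) ` K \<union> (\<lambda>x. {(x, 1), (x, 0)}) ` (- \<Union>K)"

lemma cap_blocks_cases:
  assumes "B \<in> cap_blocks K"
  obtains I h where "I \<in> K" "h = 0 \<or> h = 1" "B = I \<times> {h}"
  | x where "x \<notin> \<Union>K" "B = {(x, 1), (x, 0)}"
  using assms unfolding cap_blocks_def by blast

lemma partition_on_cap_blocks:
  assumes "disjoint K" "{} \<notin> K"
  shows "partition_on strip (cap_blocks K)"
proof (rule partition_onI)
  show "\<Union>(cap_blocks K) = strip"
    unfolding cap_blocks_def by auto
  show "{} \<notin> cap_blocks K"
  proof
    assume "{} \<in> cap_blocks K"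
    then show False
      by (cases rule: cap_blocks_cases) (use assms(2) in \<open>auto dest!: sym[of "{}"]\<close>)
  qed
  show "disjnt B C" if BC: "B \<in> cap_blocks K" "C \<in> cap_blocks K" "B \<noteq> C" for B C
  proof -
    have dis: "I \<inter> J = {}" if "I \<in> K" "J \<in> K" "I \<noteq> J" for I J
      using assms(1) that by (rule disjointD)
    show ?thesis
      using BC(1)
    proof (cases rule: cap_blocks_cases)
      case B: (1 I h)
      from BC(2) show ?thesis
      proof (cases rule: cap_blocks_cases)
        case (1 J k)
        then show ?thesis
          using B dis[of I J] BC(3) by (auto simp: disjnt_def)
      next
        case (2 y)
        then show ?thesis
          using B by (auto simp: disjnt_def)
      qed
    next
      case B: (2 x)
      from BC(2) show ?thesis
      proof (cases rule: cap_blocks_cases)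
        case (1 J k)
        then show ?thesis
          using B by (auto simp: disjnt_def)
      next
        case (2 y)
        then show ?thesis
          using B BC(3) by (auto simp: disjnt_def)
      qed
    qed
  qed
qed

lemma partition_on_Un_disjnt:
  assumes "disjnt A B" "partition_on A P" "partition_on B Q"
  shows "partition_on (A \<union> B) (P \<union> Q)"
  using assms disjoint_union[of P Q] by (auto simp: partition_on_def disjnt_def)

text \<open>
  In the middle row, the top components of \<open>Q\<close> that belong to \<open>K\<close> close up with the bottom row of the
  idempotent to contractible components; the top row of the idempotent puts them back. Everything else
  is extended by vertical lines.
\<close>

lemma stack_cap_blocks:
  assumes Q: "partition_on strip Q" and K: "\<And>I. I \<in> K \<Longrightarrow> I \<times> {1} \<in> Q" "\<And>I. I \<in> K \<Longrightarrow> finite I"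
  shows "stack_partition (cap_blocks K) Q = Q" "new_loops (cap_blocks K) Q = 0"
proof -
  \<comment> \<open>Retract the vertical lines onto their lower ends in the middle row, and keep the caps at height 2.\<close>
  define f :: "vertex \<Rightarrow> vertex" where "f = (\<lambda>(x, h). if h = 2 \<and> x \<notin> \<Union>K then (x, 1) else (x, h))"
  define top where "top = (\<lambda>I :: int set. I \<times> {1 :: nat})"
  define high where "high = (\<lambda>I :: int set. I \<times> {2 :: nat})"
  define c where "c D = tall_strip \<inter> f -` D" for D
  have Q': "\<Union>Q \<subseteq> strip"
    using partition_onD1[OF Q] by simp
  have f_strip: "f v = v" if "v \<in> strip" for v
    using that by (auto simp: f_def)
  have high_lift: "high I = lift ` top I" for I
    by (force simp: high_def top_def lift_def)
  have f_high: "f v = v" if "I \<in> K" "v \<in> high I" for v I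
    using that by (auto simp: f_def high_def)
  have top_Q: "top I \<in> Q" if "I \<in> K" for I
    using K(1)[OF that] by (simp add: top_def)
  have dis: "I = J" if "I \<in> K" "J \<in> K" "x \<in> I" "x \<in> J" for I J x
    using partition_on_same_block[OF Q top_Q[OF that(1)] top_Q[OF that(2)], of "(x, 1)"] that(3,4)
    by (auto simp: top_def)
  have f_image: "f ` tall_strip = strip \<union> \<Union>K \<times> {2}"
  proof
    show "f ` tall_strip \<subseteq> strip \<union> \<Union>K \<times> {2}"
      by (auto simp: f_def split: if_splits)
    show "strip \<union> \<Union>K \<times> {2} \<subseteq> f ` tall_strip"
    proof
      fix v assume v: "v \<in> strip \<union> \<Union>K \<times> {2}"
      then have "f v = v" "v \<in> tall_strip"
        by (auto simp: f_def)
      then show "v \<in> f ` tall_strip"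
        by (metis imageI)
    qed
  qed
  have part_high: "partition_on (\<Union>K \<times> {2}) (high ` K)"
  proof (rule partition_onI)
    show "\<Union>(high ` K) = \<Union>K \<times> {2}"
      by (auto simp: high_def)
    show "{} \<notin> high ` K"
    proof
      assume "{} \<in> high ` K"
      then obtain I where "I \<in> K" "I = {}"
        by (auto simp: high_def dest!: sym[of "{}"])
      then show False
        using top_Q[of I] partition_onD3[OF Q] by (simp add: top_def)
    qed
    show "disjnt B C" if BC: "B \<in> high ` K" "C \<in> high ` K" "B \<noteq> C" for B C
      using BC dis by (fastforce simp: high_def disjnt_def)
  qed
  have part: "partition_on (f ` tall_strip) (Q \<union> high ` K)"
    unfolding f_image by (rule partition_on_Un_disjnt[OF _ Q part_high]) (auto simp: disjnt_def)
  have comps: "stack_components (cap_blocks K) Q = (\<lambda>D. tall_strip \<inter> f -` D) ` (Q \<union> high ` K)"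
  proof (rule stack_components_retract)
    show "partition_on (f ` tall_strip) (Q \<union> high ` K)"
      by (fact part)
    show "f ` tall_strip \<subseteq> tall_strip"
      unfolding f_image by auto
    show "\<Union>Q \<subseteq> strip"
      by (fact Q')
    show "\<Union>(cap_blocks K) \<subseteq> strip"
      unfolding cap_blocks_def by auto
    show "D \<times> D \<subseteq> (stack_edges (cap_blocks K) Q)\<^sup>*" if D: "D \<in> Q \<union> high ` K" for D
      using D
    proof
      assume "D \<in> Q"
      then show ?thesis
        using stack_edgesI(2) by (auto simp del: split_paired_All)
    next
      assume "D \<in> high ` K"
      then obtain I where I: "I \<in> K" "D = lift ` top I"
        using high_lift by auto
      then have "top I \<in> cap_blocks K"
        by (auto simp: cap_blocks_def top_def)
      show ?thesis
      proof (rule subrelI)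
        fix u v assume "(u, v) \<in> D \<times> D"
        then obtain u' v' where "u' \<in> top I" "v' \<in> top I" "u = lift u'" "v = lift v'"
          unfolding I(2) by blast
        then show "(u, v) \<in> (stack_edges (cap_blocks K) Q)\<^sup>*"
          using stack_edgesI(1)[OF \<open>top I \<in> cap_blocks K\<close>] by simp
      qed
    qed
    show "\<exists>D\<in>Q \<union> high ` K. f ` B \<subseteq> D" if B: "B \<in> Q" for B
    proof (intro bexI image_subsetI)
      fix v assume "v \<in> B"
      then have "v \<in> strip"
        using Q' B by (rule_tac subsetD[OF Q']) (rule UnionI)
      then show "f v \<in> B"
        using f_strip \<open>v \<in> B\<close> by simp
    qed (use B in simp)
    show "\<exists>D\<in>Q \<union> high ` K. f ` lift ` B \<subseteq> D" if B: "B \<in> cap_blocks K" for B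
      using B
    proof (cases rule: cap_blocks_cases)
      case (1 I h)
      from 1(2) show ?thesis
      proof
        assume "h = 0"
        then have "f ` lift ` B \<subseteq> top I"
          unfolding 1(3) by (auto simp: lift_def f_def top_def)
        then show ?thesis
          using top_Q[OF 1(1)] by blast
      next
        assume "h = 1"
        then have "f ` lift ` B = f ` high I"
          unfolding 1(3) high_lift by (simp add: top_def)
        also have "\<dots> \<subseteq> high I"
          by (rule image_subsetI) (simp add: f_high[OF 1(1)])
        finally show ?thesis
          using 1(1) by blast
      qed
    next
      case (2 x)
      have "(x, 1) \<in> \<Union>Q"
        using partition_onD1[OF Q] by auto
      then obtain D where "D \<in> Q" "(x, 1) \<in> D" by blast
      moreover have "f ` lift ` B \<subseteq> {(x, 1)}"
        unfolding 2(2) using 2(1) by (auto simp: lift_def f_def)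
      ultimately show ?thesis
        by (intro bexI[of _ D]) auto
    qed
    show "(v, f v) \<in> (stack_edges (cap_blocks K) Q)\<^sup>*" if v: "v \<in> tall_strip" for v
    proof (cases "f v = v")
      case False
      then have "snd v = 2" "fst v \<notin> \<Union>K"
        by (cases v; auto simp: f_def split: if_splits)+
      then have "{(fst v, 1), (fst v, 0)} \<in> cap_blocks K"
        by (simp add: cap_blocks_def)
      then have "(lift (fst v, 1), lift (fst v, 0)) \<in> (stack_edges (cap_blocks K) Q)\<^sup>*"
        by (rule stack_edgesI) simp_all
      then show ?thesis
        using \<open>snd v = 2\<close> \<open>fst v \<notin> \<Union>K\<close> by (cases v) (simp add: lift_def f_def numeral_2_eq_2)
    qed simp
  qed
  have c_eq: "(\<lambda>D. tall_strip \<inter> f -` D) = c"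
    by (rule ext) (simp add: c_def)
  have "Q \<union> high ` K = ((Q - top ` K) \<union> high ` K) \<union> top ` K"
    using top_Q by blast
  then have C: "stack_components (cap_blocks K) Q = c ` ((Q - top ` K) \<union> high ` K) \<union> c ` top ` K"
    unfolding comps c_eq by (simp only: image_Un)
  have middle: "c (top I) = top I" if I: "I \<in> K" for I
    using I by (auto simp: c_def top_def f_def split: if_splits)
  have high: "c (high I) = high I" if I: "I \<in> K" for I
    using I by (auto simp: c_def high_def f_def split: if_splits)
  have squash_high: "squash (high I) = top I" for I
    by (force simp: squash_def high_def top_def middle_def)
  have other: "squash (c D) = D" if D: "D \<in> Q - top ` K" for D
  proof (rule Set.set_eqI)
    fix v :: vertex
    have DS: "D \<subseteq> strip"
      using D Q' by auto
    have "x \<notin> \<Union>K" if "(x, 1) \<in> D" for x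
      using partition_on_same_block[OF Q _ top_Q, of D _ "(x, 1)"] D that by (force simp: top_def)
    then have "(x, 2) \<in> c D \<longleftrightarrow> (x, 1) \<in> D" "(x, 0) \<in> c D \<longleftrightarrow> (x, 0) \<in> D" for x
      using DS by (auto simp: c_def f_def)
    then have "v \<in> squash (c D) \<longleftrightarrow> (snd v = 0 \<and> (fst v, 0) \<in> D) \<or> (snd v = 1 \<and> (fst v, 1) \<in> D)"
      by (subst mem_squash) (auto simp: c_def)
    also have "\<dots> \<longleftrightarrow> v \<in> D"
      using DS by (cases v) auto
    finally show "v \<in> squash (c D) \<longleftrightarrow> v \<in> D" .
  qed
  have other_not_middle: "\<not> c D \<subseteq> middle" if D: "D \<in> Q - top ` K" for D
  proof
    assume "c D \<subseteq> middle"
    then have "squash (c D) = {}"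
      unfolding squash_def by (simp add: Diff_eq_empty_iff)
    then show False
      using other[OF D] D partition_onD3[OF Q] by simp
  qed
  have top_middle: "top I \<subseteq> middle" for I
    by (auto simp: top_def middle_def)
  have high_not_middle: "\<not> high I \<subseteq> middle" if I: "I \<in> K" for I
  proof
    assume "high I \<subseteq> middle"
    then have "high I = {}"
      by (auto simp: high_def middle_def)
    then show False
      using partition_onD3[OF part_high] I by (metis imageI)
  qed
  have not_middle: "\<not> c D \<subseteq> middle" if "D \<in> (Q - top ` K) \<union> high ` K" for D
    using that other_not_middle high high_not_middle by (elim UnE imageE) simp_all
  have middle': "E \<subseteq> middle \<and> finite E" if "E \<in> c ` top ` K" for E
    using that
  proof (elim imageE)
    fix D I assume "E = c D" "D = top I" "I \<in> K"
    then show ?thesis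
      using middle top_middle K(2) by (simp add: top_def)
  qed
  note result = stack_by_components[OF C not_middle middle' refl]
  show "new_loops (cap_blocks K) Q = 0"
    by (rule result)
  have "stack_partition (cap_blocks K) Q = (\<lambda>D. squash (c D)) ` ((Q - top ` K) \<union> high ` K)"
    by (rule result)
  also have "\<dots> = (\<lambda>D. squash (c D)) ` (Q - top ` K) \<union> (\<lambda>I. squash (c (high I))) ` K"
    by (simp only: image_Un image_image)
  also have "\<dots> = (Q - top ` K) \<union> top ` K"
    using other squash_high high by simp
  also have "\<dots> = Q"
    using top_Q by blast
  finally show "stack_partition (cap_blocks K) Q = Q" .
qed

text \<open>
  Conjugation by a rotation moves the caps. This is what makes the sum of the images of the cap
  idempotents invariant under rotations.
\<close>

lemma rotation_cap_blocks_exchange: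
  assumes K: "disjoint K" "{} \<notin> K"
  shows "stack_partition (rotation s) (cap_blocks K) =
    stack_partition (cap_blocks ((`) ((+) s) ` K)) (rotation s)"
proof -
  let ?K = "(`) ((+) s) ` K"
  have "disjoint ?K" "{} \<notin> ?K"
    using K by (auto simp: disjoint_def image_Int[symmetric])
  then have 1: "stack_partition (cap_blocks ?K) (rotation s) = (`) (shift_rows (- s) 0) ` cap_blocks ?K"
    by (intro stack_rotation_right partition_on_cap_blocks)
  have 2: "stack_partition (rotation s) (cap_blocks K) = (`) (shift_rows 0 s) ` cap_blocks K"
    by (intro stack_rotation_left partition_on_cap_blocks K)
  have img: "shift_rows b t ` (I \<times> {h}) = (+) (if h = 0 then b else t) ` I \<times> {h}" for b t I and h :: nat
    by (auto simp: shift_rows_def image_iff)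
  have compl: "- \<Union>?K = (+) s ` (- \<Union>K)"
  proof -
    have "bij ((+) s)"
      by (rule bij_betw_byWitness[of _ "(+) (- s)"]) auto
    then have "(+) s ` (- \<Union>K) = - ((+) s ` \<Union>K)"
      by (rule bij_image_Compl_eq)
    then show ?thesis
      by (simp add: image_Union)
  qed
  have "(`) (shift_rows (- s) 0) ` cap_blocks ?K = (\<lambda>I. I \<times> {0}) ` K \<union> (\<lambda>I. (+) s ` I \<times> {1}) ` K \<union>
      (\<lambda>x. {(x + s, 1), (x, 0)}) ` (- \<Union>K)"
    unfolding cap_blocks_def compl
    by (simp add: image_Un image_image img) (simp add: shift_rows_def add.commute image_image)
  moreover have "(`) (shift_rows 0 s) ` cap_blocks K = (\<lambda>I. I \<times> {0}) ` K \<union> (\<lambda>I. (+) s ` I \<times> {1}) ` K \<union>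
      (\<lambda>x. {(x + s, 1), (x, 0)}) ` (- \<Union>K)"
    unfolding cap_blocks_def
    by (simp add: image_Un image_image img) (simp add: shift_rows_def)
  ultimately show ?thesis
    using 1 2 by simp
qed

lemma stack_rotations: "stack_partition (rotation s) (rotation t) = rotation (s + t)"
proof -
  have "partition_on strip (rotation t)"
  proof (rule partition_onI)
    show "\<Union>(rotation t) = strip"
    proof
      show "strip \<subseteq> \<Union>(rotation t)"
      proof
        fix v assume "v \<in> strip"
        then have "v \<in> {(fst v - (if snd v = 0 then 0 else t) + t, 1), (fst v - (if snd v = 0 then 0 else t), 0)}"
          by (cases v) auto
        then show "v \<in> \<Union>(rotation t)"
          unfolding rotation_def by blast
      qed
    qed (rule rotation_strip)
  qed (auto simp: rotation_def disjnt_def)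
  then have "stack_partition (rotation s) (rotation t) = (`) (shift_rows 0 s) ` rotation t"
    by (rule stack_rotation_left)
  also have "\<dots> = rotation (s + t)"
  proof -
    have "rotation u = range (\<lambda>x. {(x + u, 1), (x, 0)})" for u
      by (auto simp: rotation_def)
    then show ?thesis
      by (simp add: image_image shift_rows_def ac_simps)
  qed
  finally show ?thesis .
qed


definition cap_intervals :: "nat \<Rightarrow> int \<Rightarrow> int \<Rightarrow> int set set" where
  "cap_intervals m i w = range (\<lambda>q. {i + q * int m..i + q * int m + w})"

text \<open>
  A nonunit has an isolated top vertex (\<open>w = 0\<close>) or a component joining two adjacent top vertices
  (\<open>w = 1\<close>). The predicate says which of these can occur in the affine monoids of the given type. For
  \<open>m = 1\<close> a component joining adjacent vertices would overlap its own translate.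
\<close>

definition cap_width :: "planar_type \<Rightarrow> nat \<Rightarrow> int \<Rightarrow> bool" where
  "cap_width t m w \<longleftrightarrow>
     (w = 0 \<and> t \<noteq> Temperley_Lieb) \<or> (w = 1 \<and> m \<ge> 2 \<and> t \<noteq> Planar_Rook)"

definition cap_diagram :: "nat \<Rightarrow> int \<Rightarrow> int \<Rightarrow> diagram" where
  "cap_diagram m i w = (cap_blocks (cap_intervals m i w), 0)"

lemma cap_width_bounds: "m \<ge> 1 \<Longrightarrow> cap_width t m w \<Longrightarrow> 0 \<le> w \<and> w \<le> 1 \<and> w < int m"
  unfolding cap_width_def by auto

lemma cap_intervals_disjoint:
  assumes "0 \<le> w" "w < int m"
  shows "disjoint (cap_intervals m i w)" "{} \<notin> cap_intervals m i w"
proof -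
  have "q = q'" if x: "x \<in> {i + q * int m..i + q * int m + w}" "x \<in> {i + q' * int m..i + q' * int m + w}"
    for q q' x
  proof (rule ccontr)
    assume "q \<noteq> q'"
    then consider "q + 1 \<le> q'" | "q' + 1 \<le> q" by linarith
    then show False
    proof cases
      case 1
      then have "(q + 1) * int m \<le> q' * int m"
        by (rule mult_right_mono) simp
      then show False
        using x assms by (simp add: algebra_simps)
    next
      case 2
      then have "(q' + 1) * int m \<le> q * int m"
        by (rule mult_right_mono) simp
      then show False
        using x assms by (simp add: algebra_simps)
    qed
  qed
  then show "disjoint (cap_intervals m i w)"
    unfolding disjoint_def cap_intervals_def by blast
  show "{} \<notin> cap_intervals m i w"
    using assms(1) by (auto simp: cap_intervals_def)
qed

lemma cap_intervals_shift: "(`) ((+) s) ` cap_intervals m i w = cap_intervals m (i + s) w"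
proof -
  have *: "(+) s ` {i + q * int m..i + q * int m + w} = {i + s + q * int m..i + s + q * int m + w}" for q
    by (simp add: ac_simps)
  show ?thesis
    by (simp only: cap_intervals_def image_image *)
qed

lemma cap_intervals_periodic: "cap_intervals m (i + r * int m) w = cap_intervals m i w"
proof -
  have *: "i + r * int m + q * int m = i + (r + q) * int m" for q
    by (simp add: algebra_simps)
  have "cap_intervals m (i + r * int m) w =
      (\<lambda>q. {i + q * int m..i + q * int m + w}) ` range ((+) r)"
    by (simp only: cap_intervals_def image_image *)
  also have "range ((+) r) = UNIV"
    by (simp add: surj_plus)
  finally show ?thesis
    unfolding cap_intervals_def .
qed

lemma finite_cap_diagrams:
  assumes "m \<ge> 1"
  shows "finite {cap_diagram m i w | i w. cap_width t m w}"
proof (rule finite_subset)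
  show "{cap_diagram m i w | i w. cap_width t m w} \<subseteq>
      (\<lambda>(i, w). cap_diagram m i w) ` ({0..<int m} \<times> {0, 1})"
  proof
    fix x assume "x \<in> {cap_diagram m i w | i w. cap_width t m w}"
    then obtain i w where x: "x = cap_diagram m i w" and w: "cap_width t m w"
      by blast
    have "cap_diagram m i w = cap_diagram m (i mod int m) w"
      unfolding cap_diagram_def using cap_intervals_periodic[of m "i mod int m" "i div int m" w]
      by simp
    moreover have "i mod int m \<in> {0..<int m}"
      using assms by simp
    moreover have "w \<in> {0, 1}"
      using w by (auto simp: cap_width_def)
    ultimately show "x \<in> (\<lambda>(i, w). cap_diagram m i w) ` ({0..<int m} \<times> {0, 1})"
      unfolding x by (intro image_eqI[of _ _ "(i mod int m, w)"]) simp_all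
  qed
qed simp


text \<open>
  Planarity of the cap diagrams comes down to this: no integer lies strictly between two consecutive
  ones, so a cap cannot interlace with anything, in either role.
\<close>

lemma consecutive_not_separated:
  assumes "w \<le> 1" "fst u \<in> {j..j + w}" "fst u' \<in> {j..j + w}" "snd u = snd u'"
  shows "\<not> (boundary_less u v \<and> boundary_less v u')"
  using assms by (cases u; cases u'; cases v) (auto simp: boundary_less_def split: if_splits)

lemma planar_cap_blocks:
  assumes "w \<le> 1"
  shows "planar (cap_blocks (cap_intervals m i w), 0)"
proof -
  have interval: False
    if I: "I \<in> cap_intervals m i w" and uv: "u \<in> I \<times> {h}" "u' \<in> I \<times> {h}"
      "boundary_less u v" "boundary_less v u'"
    for I h u u' v
  proof -
    obtain j where "I = {j..j + w}"
      using I unfolding cap_intervals_def by blast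
    then show False
      using consecutive_not_separated[OF assms, of u j u' v] uv by auto
  qed
  have "\<not> interlaced B C"
    if B: "B \<in> cap_blocks (cap_intervals m i w)" and C: "C \<in> cap_blocks (cap_intervals m i w)"
      and "B \<noteq> C" for B C
  proof
    assume "interlaced B C"
    then obtain a b a' b' where ab: "a \<in> B" "b \<in> C" "a' \<in> B" "b' \<in> C"
      "boundary_less a b" "boundary_less b a'" "boundary_less a' b'"
      unfolding interlaced_def by blast
    from B show False
    proof (cases rule: cap_blocks_cases)
      case (1 I h)
      then show False
        using interval[of I a h a' b] ab by simp
    next
      case x: (2 x)
      from C show False
      proof (cases rule: cap_blocks_cases)
        case (1 I h)
        then show False
          using interval[of I b h b' a'] ab by simp
      next
        case (2 y)
        then show False
          using x ab \<open>B \<noteq> C\<close> by (auto simp: boundary_less_def)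
      qed
    qed
  qed
  then show ?thesis
    unfolding planar_def by simp
qed

lemma translate_cap_blocks:
  assumes "B \<in> cap_blocks (cap_intervals m i w)"
  shows "translate (int m) ` B \<in> cap_blocks (cap_intervals m i w)"
  using assms
proof (cases rule: cap_blocks_cases)
  case (1 I h)
  have "translate (int m) ` B = (+) (int m) ` I \<times> {h}"
    unfolding 1(3) by (auto simp: translate_def image_iff)
  moreover have "(+) (int m) ` I \<in> cap_intervals m i w"
    using cap_intervals_shift[of "int m" m i w] cap_intervals_periodic[of m i 1 w] 1(1) by auto
  ultimately show ?thesis
    using 1(2) unfolding cap_blocks_def by auto
next
  case (2 x)
  have "x + int m \<notin> \<Union>(cap_intervals m i w)"
  proof
    assume "x + int m \<in> \<Union>(cap_intervals m i w)"
    then have "x + int m \<in> \<Union>((`) ((+) (int m)) ` cap_intervals m i w)"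
      using cap_intervals_shift[of "int m" m i w] cap_intervals_periodic[of m i 1 w] by simp
    then show False
      using 2(1) by auto
  qed
  moreover have "translate (int m) ` B = {(x + int m, 1), (x + int m, 0)}"
    unfolding 2(2) by (simp add: translate_def)
  ultimately show ?thesis
    unfolding cap_blocks_def by auto
qed

lemma cap_blocks_affine:
  assumes "0 \<le> w" "w < int m"
  shows "(cap_blocks (cap_intervals m i w), c) \<in> affine_partition_diagrams m"
  unfolding affine_partition_diagrams_def
  using partition_on_cap_blocks[OF cap_intervals_disjoint[OF assms]] translate_cap_blocks by blast

lemma cap_diagram_planar:
  assumes "m \<ge> 1" "cap_width t m w"
  shows "cap_diagram m i w \<in> planar_diagrams t m"
proof -
  let ?P = "cap_blocks (cap_intervals m i w)"
  note w = cap_width_bounds[OF assms]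
  have affine: "(?P, 0) \<in> affine_partition_diagrams m"
    using cap_blocks_affine w by blast
  have planar: "planar (?P, 0)"
    using planar_cap_blocks w by blast
  have blocks: "(\<exists>j h. B = {j..j + w} \<times> {h}) \<or> (\<exists>x. B = {(x, 1), (x, 0)})" if "B \<in> ?P" for B
    using that by (cases rule: cap_blocks_cases) (auto simp: cap_intervals_def)
  have card: "finite B \<and> card B \<le> 2 \<and> (w = 1 \<longrightarrow> card B = 2)" if "B \<in> ?P" for B
    using blocks[OF that]
  proof (elim disjE exE)
    fix j h assume "B = {j..j + w} \<times> {h}"
    then have "finite B" "card B = nat (w + 1)"
      by (simp_all add: card_cartesian_product)
    then show ?thesis
      using w by auto
  next
    fix x assume "B = {(x, 1), (x, 0)}"
    then show ?thesis by simp
  qed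
  have rook: "card (top_part B) \<le> 1 \<and> card (bottom_part B) \<le> 1" if "w = 0" "B \<in> ?P" for B
  proof -
    have "\<exists>u v. top_part B \<subseteq> {u} \<and> bottom_part B \<subseteq> {v}"
      using blocks[OF that(2)]
    proof (elim disjE exE)
      fix j h assume "B = {j..j + w} \<times> {h}"
      then show ?thesis
        using that(1) by (intro exI[of _ "(j, h)"]) (auto simp: top_part_def bottom_part_def)
    next
      fix x assume "B = {(x, 1), (x, 0)}"
      then show ?thesis
        by (intro exI[of _ "(x, 1)"] exI[of _ "(x, 0)"]) (auto simp: top_part_def bottom_part_def)
    qed
    then obtain u v where "top_part B \<subseteq> {u}" "bottom_part B \<subseteq> {v}" by blast
    then show ?thesis
      using card_mono[of "{u}" "top_part B"] card_mono[of "{v}" "bottom_part B"] by simp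
  qed
  show ?thesis
    unfolding cap_diagram_def
    using affine planar card rook assms(2) by (cases t) (auto simp: cap_width_def)
qed


section \<open>Rotations are the only diagrams without top components\<close>

lemma pair_block:
  assumes "finite B" "card B \<le> 2" "u \<in> B" "v \<in> B" "u \<noteq> v"
  shows "B = {u, v}"
proof -
  have "{u, v} = B"
    by (rule card_seteq) (use assms in auto)
  then show ?thesis ..
qed

lemma interlacedI:
  "a \<in> B \<Longrightarrow> b \<in> C \<Longrightarrow> a' \<in> B \<Longrightarrow> b' \<in> C \<Longrightarrow>
    boundary_less a b \<Longrightarrow> boundary_less b a' \<Longrightarrow> boundary_less a' b' \<Longrightarrow> interlaced B C"
  unfolding interlaced_def by blast

text \<open>
  An innermost component joining two top vertices joins adjacent ones, for a vertex in between is
  confined to components that lie in between.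
\<close>

lemma innermost_top_block:
  assumes part: "partition_on strip P" and noncrossing: "\<forall>B\<in>P. \<forall>C\<in>P. B \<noteq> C \<longrightarrow> \<not> interlaced B C"
    and small: "\<forall>B\<in>P. finite B \<and> card B \<le> 2"
    and B: "{(i, 1), (j, 1)} \<in> P" "i < j"
  shows "\<exists>i. {(i, 1)} \<in> P \<or> {(i, 1), (i + 1, 1)} \<in> P"
  using B
proof (induction "nat (j - i)" arbitrary: i j rule: less_induct)
  case less
  let ?B = "{(i, 1), (j, 1)} :: vertex set"
  show ?case
  proof (cases "j = i + 1")
    case True
    then show ?thesis
      using less.prems(1) by blast
  next
    case False
    then have ij: "i < i + 1" "i + 1 < j"
      using less.prems(2) by auto
    have "(i + 1, 1) \<in> \<Union>P"
      using partition_onD1[OF part] by auto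
    then obtain C where C: "C \<in> P" "(i + 1, 1) \<in> C" by blast
    have "C \<noteq> ?B"
      using C(2) ij by auto
    then have disj: "C \<inter> ?B = {}"
      using partition_on_same_block[OF part C(1) less.prems(1)] by blast
    show ?thesis
    proof (cases "C = {(i + 1, 1)}")
      case True
      then show ?thesis
        using C(1) by blast
    next
      case False
      then obtain v where "v \<in> C" "v \<noteq> (i + 1, 1)"
        using C(2) by blast
      then obtain y h where y: "(y, h) \<in> C" "(y, h) \<noteq> (i + 1, 1)"
        by (cases v) simp
      have C_eq: "C = {(i + 1, 1), (y, h)}"
        using pair_block small C y by metis
      have "(y, h) \<in> strip"
        using partition_onD1[OF part] y(1) C(1) by blast
      then have "h = 0 \<or> h = 1" by simp
      moreover have "h \<noteq> 0"
      proof
        assume "h = 0"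
        have "interlaced C ?B"
          unfolding C_eq
          by (rule interlacedI[of "(y, h)" _ "(j, 1)" _ "(i + 1, 1)" "(i, 1)"])
            (use \<open>h = 0\<close> ij in \<open>simp_all add: boundary_less_def\<close>)
        then show False
          using noncrossing[rule_format, OF C(1) less.prems(1) \<open>C \<noteq> ?B\<close>] by contradiction
      qed
      ultimately have h: "h = 1" by simp
      have "\<not> y < i"
      proof
        assume "y < i"
        have "interlaced ?B C"
          unfolding C_eq
          by (rule interlacedI[of "(j, 1)" _ "(i + 1, 1)" _ "(i, 1)" "(y, h)"])
            (use \<open>y < i\<close> ij h in \<open>simp_all add: boundary_less_def\<close>)
        then show False
          using noncrossing[rule_format, OF less.prems(1) C(1) \<open>C \<noteq> ?B\<close>[symmetric]] by contradiction
      qed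
      moreover have "\<not> j < y"
      proof
        assume "j < y"
        have "interlaced C ?B"
          unfolding C_eq
          by (rule interlacedI[of "(y, h)" _ "(j, 1)" _ "(i + 1, 1)" "(i, 1)"])
            (use \<open>j < y\<close> ij h in \<open>simp_all add: boundary_less_def\<close>)
        then show False
          using noncrossing[rule_format, OF C(1) less.prems(1) \<open>C \<noteq> ?B\<close>] by contradiction
      qed
      moreover have "y \<noteq> i" "y \<noteq> j" "y \<noteq> i + 1"
        using disj y h unfolding C_eq by auto
      ultimately have "i + 1 < y" "y < j"
        by linarith+
      then show ?thesis
        using less.hyps[of y "i + 1"] C(1) C_eq h by auto
    qed
  qed
qed

text \<open>A strictly increasing map with \<open>f (x + m) = f x + m\<close> has no room to skip a value.\<close>

lemma periodic_strict_mono_is_shift: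
  fixes f :: "int \<Rightarrow> int"
  assumes "strict_mono f" "\<And>x. f (x + int m) = f x + int m" "m \<ge> 1"
  shows "f x = x + f 0"
proof -
  have step: "f x + 1 \<le> f (x + 1)" for x
    using strict_monoD[OF assms(1), of x "x + 1"] by simp
  have steps: "f x + int k \<le> f (x + int k)" for x k
  proof (induction k)
    case (Suc k)
    then show ?case
      using step[of "x + int k"] by (simp add: algebra_simps)
  qed simp
  have succ: "f (x + 1) = f x + 1" for x
  proof -
    have "f (x + 1) + int (m - 1) \<le> f (x + 1 + int (m - 1))"
      by (rule steps)
    also have "x + 1 + int (m - 1) = x + int m"
      using assms(3) by (simp add: of_nat_diff)
    finally show ?thesis
      using assms(2)[of x] assms(3) step[of x] by (simp add: of_nat_diff)
  qed
  show ?thesis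
  proof (induction x rule: int_induct[where k = 0])
    case (step2 i)
    then show ?case
      using succ[of "i - 1"] by simp
  qed (use succ in simp_all)
qed

text \<open>
  If no component lies in the top row, every top vertex is the end of a line to the bottom. The lines
  do not cross, so their bottom ends form an increasing periodic sequence, and they leave no bottom
  vertex free. A non-contractible loop would cross them.
\<close>

lemma no_top_block_rotation:
  assumes P: "(P, c) \<in> affine_partition_diagrams m" and "m \<ge> 1" and planar: "planar (P, c)"
    and small: "\<forall>B\<in>P. finite B \<and> card B \<le> 2"
    and no_top: "\<And>B. B \<in> P \<Longrightarrow> \<not> B \<subseteq> UNIV \<times> {1}"
  shows "\<exists>s. (P, c) = (rotation s, 0)"
proof -
  have part: "partition_on strip P" and trans: "\<And>B. B \<in> P \<Longrightarrow> translate (int m) ` B \<in> P"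
    using P unfolding affine_partition_diagrams_def by auto
  have noncrossing: "\<And>B C. B \<in> P \<Longrightarrow> C \<in> P \<Longrightarrow> B \<noteq> C \<Longrightarrow> \<not> interlaced B C"
    using planar unfolding planar_def by auto
  have "\<exists>y. {(x, 1), (y, 0)} \<in> P" for x
  proof -
    have "(x, 1) \<in> \<Union>P"
      using partition_onD1[OF part] by auto
    then obtain B where B: "B \<in> P" "(x, 1) \<in> B" by blast
    then obtain y h where y: "(y, h) \<in> B" "h \<noteq> 1"
      using no_top[OF B(1)] by auto
    moreover have "(y, h) \<in> strip"
      using partition_onD1[OF part] y(1) B(1) by blast
    ultimately have "(y, 0) \<in> B" by simp
    then have "B = {(x, 1), (y, 0)}"
      using pair_block[of B "(x, 1)" "(y, 0)"] small B by auto
    then show ?thesis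
      using B(1) by blast
  qed
  then obtain f where f: "\<And>x. {(x, 1), (f x, 0)} \<in> P" by metis
  have determined: "f x = y" if "(x, 1) \<in> B" "(y, 0) \<in> B" "B \<in> P" for x y B
    using partition_on_same_block[OF part that(3) f that(1)] that(2) by auto
  have "strict_mono f"
  proof (rule strict_monoI)
    fix x y :: int assume "x < y"
    let ?B = "{(x, 1), (f x, 0)} :: vertex set" and ?C = "{(y, 1), (f y, 0)} :: vertex set"
    have ne: "?B \<noteq> ?C"
      using \<open>x < y\<close> by (auto simp: doubleton_eq_iff)
    have "f x \<noteq> f y"
    proof
      assume eq: "f x = f y"
      have "?B = ?C"
        by (rule partition_on_same_block[OF part f f, of "(f x, 0)"]) (simp_all add: eq)
      then show False
        using ne by contradiction
    qed
    moreover have "\<not> f y < f x"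
    proof
      assume "f y < f x"
      have "interlaced ?C ?B"
        by (rule interlacedI[of "(f y, 0)" _ "(f x, 0)" _ "(y, 1)" "(x, 1)"])
            (use \<open>f y < f x\<close> \<open>x < y\<close> in \<open>simp_all add: boundary_less_def\<close>)
      then show False
        using noncrossing[OF f f ne[symmetric]] by contradiction
    qed
    ultimately show "f x < f y" by simp
  qed
  moreover have "f (x + int m) = f x + int m" for x
  proof (rule determined)
    show "translate (int m) ` {(x, 1), (f x, 0)} \<in> P"
      using trans f .
  qed (simp_all add: translate_def)
  ultimately have shift: "f x = x + f 0" for x
    using periodic_strict_mono_is_shift \<open>m \<ge> 1\<close> by blast
  have "P = rotation (- f 0)"
  proof (intro subset_antisym subsetI)
    fix B assume "B \<in> rotation (- f 0)"
    then obtain x where x: "B = {(x - f 0, 1), (x, 0)}"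
      unfolding rotation_def by auto
    show "B \<in> P"
      using f[of "x - f 0"] shift[of "x - f 0"] unfolding x by simp
  next
    fix B assume B: "B \<in> P"
    then obtain x h where xh: "(x, h) \<in> B"
      using partition_onD3[OF part] by (metis ex_in_conv surj_pair)
    have "(x, h) \<in> strip"
      using partition_onD1[OF part] xh B by blast
    then consider "h = 1" | "h = 0" by auto
    then have "\<exists>z. B = {(z, 1), (f z, 0)}"
    proof cases
      case 1
      have "B = {(x, 1), (f x, 0)}"
        by (rule partition_on_same_block[OF part B f xh]) (simp add: 1)
      then show ?thesis ..
    next
      case 2
      have "f (x - f 0) = x"
        using shift[of "x - f 0"] by simp
      then have "B = {(x - f 0, 1), (f (x - f 0), 0)}"
        by (intro partition_on_same_block[OF part B f xh]) (simp add: 2)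
      then show ?thesis ..
    qed
    then obtain z where "B = {(z, 1), (f z, 0)}" ..
    then have "B = {(f z + - f 0, 1), (f z, 0)}"
      using shift[of z] by simp
    then show "B \<in> rotation (- f 0)"
      unfolding rotation_def by blast
  qed
  moreover have "c = 0"
  proof (rule ccontr)
    assume "c \<noteq> 0"
    then have "\<forall>B\<in>P. top_part B = {} \<or> bottom_part B = {}"
      using planar unfolding planar_def by auto
    then have "top_part {(0, 1), (f 0, 0)} = {} \<or> bottom_part {(0, 1), (f 0, 0)} = {}"
      using f by blast
    then show False
      by (auto simp: top_part_def bottom_part_def)
  qed
  ultimately show ?thesis by blast
qed

text \<open>
  The classification behind the affine case: an element is a rotation, or it can absorb one of
  finitely many cap idempotents on the left.
\<close>

lemma planar_diagram_cases:
  assumes P: "(P, c) \<in> planar_diagrams t m" and "m \<ge> 1"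
  obtains s where "(P, c) = (rotation s, 0)"
  | i w where "cap_width t m w" "{i..i + w} \<times> {1} \<in> P"
proof -
  have affine: "(P, c) \<in> affine_partition_diagrams m" and planar: "planar (P, c)"
    using P by (cases t; simp)+
  have part: "partition_on strip P" and trans: "\<And>B. B \<in> P \<Longrightarrow> translate (int m) ` B \<in> P"
    using affine unfolding affine_partition_diagrams_def by auto
  have noncrossing: "\<forall>B\<in>P. \<forall>C\<in>P. B \<noteq> C \<longrightarrow> \<not> interlaced B C"
    using planar unfolding planar_def by auto
  have small: "\<forall>B\<in>P. finite B \<and> card B \<le> 2"
  proof
    fix B assume B: "B \<in> P"
    show "finite B \<and> card B \<le> 2"
    proof (cases t)
      case Temperley_Lieb
      then have "card B = 2"
        using P B by auto
      then show ?thesis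
        using card.infinite by force
    next
      case Motzkin
      then show ?thesis
        using P B by auto
    next
      case Planar_Rook
      then have *: "finite B" "card (top_part B) \<le> 1" "card (bottom_part B) \<le> 1"
        using P B by auto
      have "B \<subseteq> strip"
        using partition_onD1[OF part] B by blast
      then have "B = top_part B \<union> bottom_part B"
        by (auto simp: top_part_def bottom_part_def)
      then show ?thesis
        using * card_Un_le[of "top_part B" "bottom_part B"] by simp
    qed
  qed
  have single: "cap_width t m 0" if "{(i, 1)} \<in> P" for i
  proof -
    have "t \<noteq> Temperley_Lieb"
      using P that by force
    then show ?thesis
      by (simp add: cap_width_def)
  qed
  have pair: "cap_width t m 1" if B: "{(i, 1), (i + 1, 1)} \<in> P" for i
  proof -
    have "t \<noteq> Planar_Rook"
    proof
      assume "t = Planar_Rook"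
      then have "card (top_part {(i, 1), (i + 1, 1)}) \<le> 1"
        using P B by auto
      moreover have "top_part {(i, 1), (i + 1, 1)} = {(i, 1), (i + 1, 1)}"
        by (auto simp: top_part_def)
      ultimately show False by simp
    qed
    moreover have "m \<noteq> 1"
    proof
      assume "m = 1"
      then have "{(i + 1, 1), (i + 2, 1)} \<in> P"
        using trans[OF B] by (simp add: translate_def ac_simps)
      then have "{(i + 1, 1), (i + 2, 1)} = ({(i, 1), (i + 1, 1)} :: vertex set)"
        using partition_on_same_block[OF part _ B, of _ "(i + 1, 1)"] by simp
      then show False
        by (auto simp: doubleton_eq_iff)
    qed
    ultimately show ?thesis
      using \<open>m \<ge> 1\<close> by (simp add: cap_width_def)
  qed
  have interval: "{i..i + 0} \<times> {1} = {(i, 1)}" "{i..i + 1} \<times> {1} = {(i, 1), (i + 1, 1)}" for i :: int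
    by auto
  show thesis
  proof (cases "\<exists>B\<in>P. B \<subseteq> UNIV \<times> {1}")
    case False
    then show thesis
      using no_top_block_rotation[OF affine \<open>m \<ge> 1\<close> planar small] that(1) by blast
  next
    case True
    then obtain B where B: "B \<in> P" "B \<subseteq> UNIV \<times> {1}" by blast
    then obtain v where v: "v \<in> B"
      using partition_onD3[OF part] by (metis ex_in_conv)
    then have x: "(fst v, 1) \<in> B"
      using B(2) by (cases v) auto
    let ?x = "fst v"
    have "\<exists>i. {(i, 1)} \<in> P \<or> {(i, 1), (i + 1, 1)} \<in> P"
    proof (cases "B = {(?x, 1)}")
      case True
      then show ?thesis
        using B(1) by blast
    next
      case False
      then obtain u where u: "u \<in> B" "u \<noteq> (?x, 1)"
        using x by blast
      then obtain y where y: "(y, 1) \<in> B" "y \<noteq> ?x"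
        using B(2) by (cases u) auto
      then have "B = {(?x, 1), (y, 1)}"
        using pair_block small B(1) x by (metis prod.inject)
      then have "{(?x, 1), (y, 1)} \<in> P" "{(y, 1), (?x, 1)} \<in> P"
        using B(1) by (simp_all add: insert_commute)
      then show ?thesis
        using innermost_top_block[OF part noncrossing small] y(2) by (metis linorder_neqE)
    qed
    then show thesis
      using single pair interval that(2) by metis
  qed
qed


section \<open>The planar diagram monoids\<close>

lemma loop_free_mult:
  assumes "new_loops P Q = 0"
  shows "affine_mult (P, 0) (Q, d) = (stack_partition P Q, d)"
    and "reduced_mult (P, 0) (Q, 0) = (stack_partition P Q, 0)"
  using assms by (simp_all add: affine_mult_def reduced_mult_def)

lemma planar_diagram_partition:
  assumes "(P, c) \<in> planar_diagrams t m"
  shows "partition_on strip P" and "\<And>B. B \<in> P \<Longrightarrow> translate (int m) ` B \<in> P"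
  using assms by (cases t; auto simp: affine_partition_diagrams_def)+

text \<open>The identity has no component in the top row, whereas such components survive multiplication.\<close>

lemma top_block_nonunit:
  fixes M :: "diagram monoid"
  assumes mult: "monoid.mult M = affine_mult \<or> monoid.mult M = reduced_mult" and one: "one M = id_diagram"
    and strip: "\<And>y. y \<in> carrier M \<Longrightarrow> \<Union>(fst y) \<subseteq> strip"
    and x: "partition_on strip (fst x)" "B \<in> fst x" "B \<subseteq> UNIV \<times> {1}"
  shows "x \<notin> Units M"
proof
  assume "x \<in> Units M"
  then obtain y where y: "y \<in> carrier M" "x \<otimes>\<^bsub>M\<^esub> y = id_diagram"
    unfolding Units_def using one by auto
  have "fst (x \<otimes>\<^bsub>M\<^esub> y) = stack_partition (fst x) (fst y)"
    using mult by (cases x; cases y) (auto simp: affine_mult_def reduced_mult_def)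
  then show False
    using top_block_not_right_invertible[OF x(1) strip[OF y(1)] x(2,3)] y(2) by simp
qed

text \<open>
  By translation invariance a diagram contains all translates of a cap, so the cap idempotent is a
  left identity for it.
\<close>

lemma cap_intervals_in_diagram:
  assumes P: "(P, c) \<in> planar_diagrams t m" and B: "{i..i + w} \<times> {1} \<in> P" and I: "I \<in> cap_intervals m i w"
  shows "I \<times> {1} \<in> P"
proof -
  note part = planar_diagram_partition(1)[OF P] and trans = planar_diagram_partition(2)[OF P]
  let ?J = "\<lambda>q :: int. {i + q * int m..i + q * int m + w}"
  have step: "translate (int m) ` (?J q \<times> {1}) = ?J (q + 1) \<times> {1}" for q
  proof -
    have "translate (int m) ` (I \<times> {1}) = (+) (int m) ` I \<times> {1}" for I
      by (auto simp: translate_def image_iff)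
    then have "translate (int m) ` (?J q \<times> {1}) = (+) (int m) ` ?J q \<times> {1}" .
    also have "(+) (int m) ` ?J q = ?J (q + 1)"
      by (simp add: algebra_simps)
    finally show ?thesis .
  qed
  \<comment> \<open>Invariance is stated for translation to the right. The translate to the left is recovered as the
    component through one of its vertices.\<close>
  have down: "?J q \<times> {1} \<in> P" if succ: "?J (q + 1) \<times> {1} \<in> P" for q
  proof -
    have "?J (q + 1) \<times> {1 :: nat} \<noteq> {}"
      using succ partition_onD3[OF part] by metis
    then have "(i + q * int m, 1) \<in> ?J q \<times> {1}"
      by auto
    then have "translate (int m) (i + q * int m, 1) \<in> translate (int m) ` (?J q \<times> {1})"
      by (rule imageI)
    then have J: "translate (int m) (i + q * int m, 1) \<in> ?J (q + 1) \<times> {1}"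
      unfolding step .
    have "(i + q * int m, 1) \<in> \<Union>P"
      using partition_onD1[OF part] by auto
    then obtain C where C: "C \<in> P" "(i + q * int m, 1) \<in> C" by blast
    have "translate (int m) ` C = ?J (q + 1) \<times> {1}"
      by (rule partition_on_same_block[OF part trans[OF C(1)] succ imageI[OF C(2)] J])
    then have "translate (int m) ` C = translate (int m) ` (?J q \<times> {1})"
      unfolding step .
    moreover have "inj (translate (int m))"
      by (auto simp: translate_def inj_def)
    ultimately show ?thesis
      using C(1) by (simp add: inj_image_eq_iff)
  qed
  obtain q where q: "I = ?J q"
    using I unfolding cap_intervals_def by blast
  have "?J q \<times> {1} \<in> P"
  proof (induction q rule: int_induct[where k = 0])
    case base
    show ?case using B by simp
  next
    case (step1 q)
    then show ?case
      using trans step[of q] by metis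
  next
    case (step2 q)
    then show ?case
      using down[of "q - 1"] by simp
  qed
  then show ?thesis
    unfolding q .
qed

text \<open>
  Here \<open>U\<close> consists of the rotations, which commute, and \<open>X\<close> of the cap idempotents. An element with a
  cap factors through the corresponding idempotent, and rotations permute the idempotents by
  conjugation.
\<close>

lemma affine_monoid_bounds:
  fixes scale :: "'k::alg_closed_field \<Rightarrow> 'v::ab_group_add \<Rightarrow> 'v"
  assumes "m \<ge> 1" and M: "M = affine_monoid t m \<or> M = reduced_affine_monoid t m"
    and mod: "fin_dim_monoid_module scale M \<rho>"
    and nonunits: "\<forall>x \<in> carrier M - Units M. \<not> bij (\<rho> x)"
  shows "\<exists>r. \<forall>n. tensor_power_length scale M \<rho> n \<le> vector_space.dim scale (UNIV :: 'v set) ^ n \<and>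
    vector_space.dim scale (UNIV :: 'v set) ^ n \<le>
      r * (vector_space.dim scale (UNIV :: 'v set) - 1) ^ n + tensor_power_length scale M \<rho> n"
proof -
  interpret fin_dim_monoid_module scale M \<rho> by (fact mod)
  define X where "X = {cap_diagram m i w | i w. cap_width t m w}"
  define U where "U = {g \<in> carrier M. \<exists>s. g = (rotation s, 0)}"
  have planar: "g \<in> planar_diagrams t m" if "g \<in> carrier M" for g
    using that M by (auto simp: affine_monoid_def reduced_affine_monoid_def)
  have mult: "(P, 0) \<otimes>\<^bsub>M\<^esub> (Q, d) = (stack_partition P Q, d)"
    if "new_loops P Q = 0" "(Q, d) \<in> carrier M" for P Q d
    using M
  proof
    assume "M = affine_monoid t m"
    then show ?thesis
      using loop_free_mult(1)[OF that(1)] by (simp add: affine_monoid_def)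
  next
    assume "M = reduced_affine_monoid t m"
    then show ?thesis
      using loop_free_mult(2)[OF that(1)] that(2) by (simp add: reduced_affine_monoid_def)
  qed
  have mult_one: "monoid.mult M = affine_mult \<or> monoid.mult M = reduced_mult" "one M = id_diagram"
    using M by (auto simp: affine_monoid_def reduced_affine_monoid_def)
  have X_carrier: "X \<subseteq> carrier M"
  proof
    fix x assume "x \<in> X"
    then obtain i w where "cap_width t m w" "x = cap_diagram m i w"
      unfolding X_def by blast
    then have "x \<in> planar_diagrams t m" "snd x = 0"
      using cap_diagram_planar[OF \<open>m \<ge> 1\<close>] by (auto simp: cap_diagram_def)
    then show "x \<in> carrier M"
      using M by (cases x) (auto simp: affine_monoid_def reduced_affine_monoid_def)
  qed
  have part: "partition_on strip (fst g)" if "g \<in> carrier M" for g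
    using planar[OF that] planar_diagram_partition(1) by (cases g) auto
  have strip: "\<Union>(fst g) \<subseteq> strip" if "g \<in> carrier M" for g
    using partition_onD1[OF part[OF that]] by simp
  have X_nonunit: "\<not> bij (\<rho> x)" if "x \<in> X" for x
  proof -
    obtain i w where w: "cap_width t m w" "x = cap_diagram m i w"
      using \<open>x \<in> X\<close> unfolding X_def by blast
    have "{i + 0 * int m..i + 0 * int m + w} \<in> cap_intervals m i w"
      unfolding cap_intervals_def by (rule rangeI)
    then have "{i..i + w} \<times> {1} \<in> fst x"
      using w(2) by (simp add: cap_diagram_def cap_blocks_def)
    moreover have "x \<in> carrier M"
      using X_carrier \<open>x \<in> X\<close> by (rule subsetD)
    ultimately have "x \<notin> Units M"
      using top_block_nonunit[OF mult_one strip part, of x "{i..i + w} \<times> {1}"] by auto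
    then show ?thesis
      using nonunits X_carrier \<open>x \<in> X\<close> by blast
  qed
  have factor: "g \<in> U \<or> (\<exists>x\<in>X. \<exists>y\<in>carrier M. \<rho> g = \<rho> x \<circ> \<rho> y)" if g: "g \<in> carrier M" for g
  proof -
    obtain P c where P: "g = (P, c)" by (cases g)
    have Pc: "(P, c) \<in> planar_diagrams t m"
      using planar g P by simp
    from planar_diagram_cases[OF Pc \<open>m \<ge> 1\<close>] show ?thesis
    proof cases
      case (1 s)
      then show ?thesis
        using g P unfolding U_def by blast
    next
      case (2 i w)
      have K: "I \<times> {1} \<in> P" "finite I" if "I \<in> cap_intervals m i w" for I
        using cap_intervals_in_diagram[OF Pc 2(2) that] that by (auto simp: cap_intervals_def)
      note stack = stack_cap_blocks[OF planar_diagram_partition(1)[OF Pc] K]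
      have x: "cap_diagram m i w \<in> X"
        unfolding X_def using 2(1) by blast
      have "cap_diagram m i w \<otimes>\<^bsub>M\<^esub> g = g"
        using mult[OF stack(2)] g stack(1) unfolding P cap_diagram_def by simp
      then have "\<rho> g = \<rho> (cap_diagram m i w) \<circ> \<rho> g"
        using action_mult[of "cap_diagram m i w" g] x X_carrier g by auto
      then show ?thesis
        using x g by blast
    qed
  qed
  have commute: "\<rho> g \<circ> \<rho> h = \<rho> h \<circ> \<rho> g" if gh: "g \<in> U" "h \<in> U" for g h
  proof -
    obtain s s' where s: "g = (rotation s, 0)" "h = (rotation s', 0)" "g \<in> carrier M" "h \<in> carrier M"
      using gh unfolding U_def by blast
    have "partition_on strip (rotation s)" "partition_on strip (rotation s')"
      using part[OF s(3)] part[OF s(4)] s(1,2) by simp_all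
    then have "g \<otimes>\<^bsub>M\<^esub> h = (rotation (s + s'), 0)" "h \<otimes>\<^bsub>M\<^esub> g = (rotation (s' + s), 0)"
      using mult s stack_rotations stack_rotation_left(2) by simp_all
    then show ?thesis
      using action_mult[OF s(3,4)] action_mult[OF s(4,3)] by (simp add: add.commute)
  qed
  have exchange: "\<exists>x'\<in>X. \<exists>y\<in>carrier M. \<rho> g \<circ> \<rho> x = \<rho> x' \<circ> \<rho> y" if gx: "g \<in> U" "x \<in> X" for g x
  proof -
    obtain s where s: "g = (rotation s, 0)" "g \<in> carrier M"
      using gx(1) unfolding U_def by blast
    obtain i w where w: "cap_width t m w" "x = cap_diagram m i w"
      using gx(2) unfolding X_def by blast
    have x': "cap_diagram m (i + s) w \<in> X"
      unfolding X_def using w(1) by blast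
    then have carrier: "x \<in> carrier M" "cap_diagram m (i + s) w \<in> carrier M"
      using gx(2) X_carrier by auto
    note bounds = cap_width_bounds[OF \<open>m \<ge> 1\<close> w(1)]
    have "g \<otimes>\<^bsub>M\<^esub> x = (stack_partition (rotation s) (cap_blocks (cap_intervals m i w)), 0)"
      using mult[of "rotation s" "cap_blocks (cap_intervals m i w)" 0] stack_rotation_left(2) part[OF carrier(1)]
        carrier(1) unfolding s(1) w(2) cap_diagram_def by simp
    also have "\<dots> = (stack_partition (cap_blocks (cap_intervals m (i + s) w)) (rotation s), 0)"
      using rotation_cap_blocks_exchange[of "cap_intervals m i w" s] cap_intervals_disjoint[of w m i] bounds
      by (simp add: cap_intervals_shift)
    also have "\<dots> = cap_diagram m (i + s) w \<otimes>\<^bsub>M\<^esub> g"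
      using mult[of "cap_blocks (cap_intervals m (i + s) w)" "rotation s" 0] stack_rotation_right(2)
        part[OF carrier(2)] s unfolding cap_diagram_def by simp
    finally have "\<rho> g \<circ> \<rho> x = \<rho> (cap_diagram m (i + s) w) \<circ> \<rho> g"
      using action_mult[OF s(2) carrier(1)] action_mult[OF carrier(2) s(2)] by simp
    then show ?thesis
      using x' s(2) by blast
  qed
  have "finite X"
    unfolding X_def by (rule finite_cap_diagrams[OF \<open>m \<ge> 1\<close>])
  note bounds = tensor_power_length_bounds[OF mod this X_carrier X_nonunit factor commute exchange]
  show ?thesis
    using bounds by blast
qed

lemma generator_top_block:
  assumes "h \<in> generators t m"
  shows "\<exists>B\<in>fst h. B \<subseteq> UNIV \<times> {1}"
proof -
  have self: "B \<in> fst (periodic_diagram m i Bs)" if "B \<in> Bs" for B i Bs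
  proof -
    have "translate (0 * int m) ` B = B"
      by (simp add: translate_def)
    then show ?thesis
      using that unfolding periodic_diagram_def fst_conv
      by (intro UnI1 CollectI exI[of _ "0 :: int"] exI[of _ B] conjI) simp_all
  qed
  have "\<exists>B\<in>fst (e_diagram m i). B \<subseteq> UNIV \<times> {1}" for i
    using self[of "{(i, 1), (i + 1, 1)}"] unfolding e_diagram_def by (rule bexI[rotated]) auto
  moreover have "\<exists>B\<in>fst (l_diagram m i). B \<subseteq> UNIV \<times> {1}" for i
    using self[of "{(i, 1)}"] unfolding l_diagram_def by (rule bexI[rotated]) auto
  moreover have "\<exists>B\<in>fst (r_diagram m i). B \<subseteq> UNIV \<times> {1}" for i
    using self[of "{(i + 1, 1)}"] unfolding r_diagram_def by (rule bexI[rotated]) auto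
  ultimately show ?thesis
    using assms by (cases t) auto
qed

text \<open>
  Here the generators themselves serve as \<open>X\<close>: each has a component in the top row and so is a
  nonunit. An element other than the identity starts with a generator. This is shown for the operators
  by induction over words, where a product of words is regrouped by associativity of composition, and
  words that act as the identity form \<open>U\<close>.
\<close>

lemma generated_monoid_bounds:
  fixes scale :: "'k::alg_closed_field \<Rightarrow> 'v::ab_group_add \<Rightarrow> 'v"
  assumes G: "G = affine_monoid t m \<or> G = reduced_affine_monoid t m"
    and M: "M = generated_submonoid G (generators t m)"
    and mod: "fin_dim_monoid_module scale M \<rho>"
    and nonunits: "\<forall>x \<in> carrier M - Units M. \<not> bij (\<rho> x)"
  shows "\<exists>r. \<forall>n. tensor_power_length scale M \<rho> n \<le> vector_space.dim scale (UNIV :: 'v set) ^ n \<and>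
    vector_space.dim scale (UNIV :: 'v set) ^ n \<le>
      r * (vector_space.dim scale (UNIV :: 'v set) - 1) ^ n + tensor_power_length scale M \<rho> n"
proof -
  interpret fin_dim_monoid_module scale M \<rho> by (fact mod)
  define X where "X = generators t m \<inter> carrier G"
  have carrier_M: "carrier M = submonoid_span G X"
    and mult_M: "monoid.mult M = monoid.mult G" and one_M: "one M = one G"
    unfolding M generated_submonoid_def X_def by simp_all
  have mult_one: "monoid.mult M = affine_mult \<or> monoid.mult M = reduced_mult" "one M = id_diagram"
    using G unfolding mult_M one_M by (auto simp: affine_monoid_def reduced_affine_monoid_def)
  have part: "partition_on strip (fst x)" if "x \<in> X" for x
  proof -
    have "x \<in> planar_diagrams t m"
      using that G by (auto simp: X_def affine_monoid_def reduced_affine_monoid_def)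
    then show ?thesis
      using planar_diagram_partition(1) by (cases x) auto
  qed
  have strip: "\<Union>(fst y) \<subseteq> strip" if "y \<in> carrier M" for y
    using that unfolding carrier_M
  proof (induction rule: submonoid_span.induct)
    case one
    show ?case
      using mult_one(2) one_M by (auto simp: id_diagram_def)
  next
    case (incl h)
    then show ?case
      using partition_onD1[OF part[OF incl]] by simp
  next
    case (mult g h)
    have "fst (g \<otimes>\<^bsub>G\<^esub> h) = stack_partition (fst g) (fst h)"
      using mult_one(1) mult_M by (cases g; cases h) (auto simp: affine_mult_def reduced_mult_def)
    then show ?case
      using stack_partition_strip mult.IH by simp
  qed
  have X_carrier: "X \<subseteq> carrier M"
    unfolding carrier_M by (rule subsetI) (rule submonoid_span.incl)
  have X_nonunit: "\<not> bij (\<rho> x)" if "x \<in> X" for x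
  proof -
    have "x \<in> generators t m"
      using that by (simp add: X_def)
    then obtain B where "B \<in> fst x" "B \<subseteq> UNIV \<times> {1}"
      using generator_top_block by blast
    then have "x \<notin> Units M"
      by (rule top_block_nonunit[OF mult_one strip part[OF that], rotated])
    then show ?thesis
      using nonunits X_carrier that by blast
  qed
  define U where "U = {g \<in> carrier M. \<rho> g = id}"
  have one_carrier: "\<one>\<^bsub>M\<^esub> \<in> carrier M"
    unfolding carrier_M one_M by (rule submonoid_span.one)
  have factor: "g \<in> U \<or> (\<exists>x\<in>X. \<exists>y\<in>carrier M. \<rho> g = \<rho> x \<circ> \<rho> y)" if g: "g \<in> carrier M" for g
  proof -
    have "\<rho> g = id \<or> (\<exists>x\<in>X. \<exists>y\<in>carrier M. \<rho> g = \<rho> x \<circ> \<rho> y)"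
      using g unfolding carrier_M
    proof (induction rule: submonoid_span.induct)
      case one
      then show ?case
        using action_one one_M by simp
    next
      case (incl h)
      then have "\<rho> h = \<rho> h \<circ> \<rho> \<one>\<^bsub>M\<^esub>"
        using action_one by simp
      then show ?case
        using incl one_carrier unfolding carrier_M by blast
    next
      case (mult g h)
      then have gh: "g \<in> carrier M" "h \<in> carrier M"
        unfolding carrier_M by simp_all
      have eq: "\<rho> (g \<otimes>\<^bsub>G\<^esub> h) = \<rho> g \<circ> \<rho> h"
        using action_mult[OF gh] mult_M by simp
      from mult.IH(1) show ?case
      proof
        assume "\<rho> g = id"
        then show ?thesis
          using mult.IH(2) eq by simp
      next
        assume "\<exists>x\<in>X. \<exists>y\<in>submonoid_span G X. \<rho> g = \<rho> x \<circ> \<rho> y"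
        then obtain x y where xy: "x \<in> X" "y \<in> submonoid_span G X" "\<rho> g = \<rho> x \<circ> \<rho> y" by blast
        have "\<rho> (y \<otimes>\<^bsub>G\<^esub> h) = \<rho> y \<circ> \<rho> h"
          using action_mult[of y h] xy(2) gh(2) mult_M carrier_M by simp
        then have "\<rho> (g \<otimes>\<^bsub>G\<^esub> h) = \<rho> x \<circ> \<rho> (y \<otimes>\<^bsub>G\<^esub> h)"
          using eq xy(3) by (simp add: comp_assoc)
        moreover have "y \<otimes>\<^bsub>G\<^esub> h \<in> submonoid_span G X"
          using xy(2) mult.hyps(2) by (rule submonoid_span.mult)
        ultimately show ?thesis
          using xy(1) by blast
      qed
    qed
    then show ?thesis
      using g unfolding U_def by simp
  qed
  have commute: "\<rho> g \<circ> \<rho> h = \<rho> h \<circ> \<rho> g" if "g \<in> U" "h \<in> U" for g h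
    using that unfolding U_def by simp
  have exchange: "\<exists>x'\<in>X. \<exists>y\<in>carrier M. \<rho> g \<circ> \<rho> x = \<rho> x' \<circ> \<rho> y" if "g \<in> U" "x \<in> X" for g x
    using that one_carrier action_one unfolding U_def by (intro bexI[of _ x] bexI[of _ "\<one>\<^bsub>M\<^esub>"]) simp_all
  have "finite (generators t m)"
    by (cases t) simp_all
  then have "finite X"
    unfolding X_def by simp
  note bounds = tensor_power_length_bounds[OF mod this X_carrier X_nonunit factor commute exchange]
  show ?thesis
    using bounds by blast
qed

theorem corollary4p3p2:
  fixes scale :: "'k::alg_closed_field \<Rightarrow> 'v::ab_group_add \<Rightarrow> 'v"
    and M :: "diagram monoid"
    and \<rho> :: "diagram \<Rightarrow> 'v \<Rightarrow> 'v"
    and t :: planar_type and v :: variant and m :: nat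
  assumes "m \<ge> 1"
    and "M = planar_diagram_monoid v t m"
    and "fin_dim_monoid_module scale M \<rho>"
    and nonunits: "\<forall>x \<in> carrier M - Units M. \<not> bij (\<rho> x)"
    and faithful: "inj_on \<rho> (Units M)"
  shows "(\<lambda>n. real (tensor_power_length scale M \<rho> n))
           \<sim>[sequentially] (\<lambda>n. real (vector_space.dim scale (UNIV :: 'v set)) ^ n)"
proof -
  have "\<exists>r. \<forall>n. tensor_power_length scale M \<rho> n \<le> vector_space.dim scale (UNIV :: 'v set) ^ n \<and>
    vector_space.dim scale (UNIV :: 'v set) ^ n \<le>
      r * (vector_space.dim scale (UNIV :: 'v set) - 1) ^ n + tensor_power_length scale M \<rho> n"
  proof (cases v)
    case Affine
    then show ?thesis
      using affine_monoid_bounds[where t = t, OF assms(1) _ assms(3,4)] assms(2) by simp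
  next
    case Reduced_Affine
    then show ?thesis
      using affine_monoid_bounds[where t = t, OF assms(1) _ assms(3,4)] assms(2) by simp
  next
    case Periodic
    then show ?thesis
      using generated_monoid_bounds[where t = t, OF _ _ assms(3,4)] assms(2) by simp
  next
    case Reduced_Periodic
    then show ?thesis
      using generated_monoid_bounds[where t = t, OF _ _ assms(3,4)] assms(2) by simp
  qed
  then obtain r where "\<And>n. tensor_power_length scale M \<rho> n \<le> vector_space.dim scale (UNIV :: 'v set) ^ n"
    "\<And>n. vector_space.dim scale (UNIV :: 'v set) ^ n \<le>
      r * (vector_space.dim scale (UNIV :: 'v set) - 1) ^ n + tensor_power_length scale M \<rho> n"
    by blast
  then show ?thesis
    by (rule asymp_equiv_powers)
qed

end
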